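(* Assume binary sensor messages ($l=2$). For each $m=0,\dots,M-1$, a maximin quantizer $\bar\phi^{\max}_m$ for state $m$ exists, and it can be chosen as a randomization of at most $M-1$ deterministic quantizers. Moreover, if the densities $f_0,\dots,f_{M-1}$ are linearly independent, then $\bar\phi^{\max}_m$ can be chosen as a randomization of at most $M-1$ deterministic unambiguous likelihood quantizers (ULQs).
   Context: Setting: a raw observation $X$ has, under state $m\in\{0,\dots,M-1\}$ (probability $\mathbf P_m$), density $f_m$ with respect to a common $\sigma$-finite measure. Standing assumption: for all $m\neq m'$, $0<\mathbf E_m[\log(f_m(X)/f_{m'}(X))]<\infty$. A deterministic quantizer is a measurable map $\phi$ from the observation space to $\{0,1\}$; $\Phi$ is the set of these. A randomized quantizer $\bar\phi=\sum_j p^j\phi^j$ is a probability distribution $(p^j)$ on a countable set $\{\phi^j\}\subset\Phi$; deterministic quantizers are identified with randomized ones of mass one; $\bar\Phi$ is the set of all quantizers. For $\phi\in\Phi$, $f_m(u;\phi)=\mathbf P_m(\phi(X)=u)$ and $I(m,m';\phi)=\sum_{u}f_m(u;\phi)\log\frac{f_m(u;\phi)}{f_{m'}(u;\phi)}$; for $\bar\phi=\sum_jp^j\phi^j$, $I(m,m';\bar\phi)=\sum_jp^jI(m,m';\phi^j)$; $I(m;\bar\phi)=\min_{m'\neq m}I(m,m';\bar\phi)$; $I(m)=\sup_{\bar\phi\in\bar\Phi}I(m;\bar\phi)$; a maximin quantizer for state $m$ is a $\bar\phi\in\bar\Phi$ with $I(m;\bar\phi)=I(m)$. A deterministic quantizer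 $\phi$ is an unambiguous likelihood quantizer (ULQ) if there are reals $a_0,\dots,a_{M-1}$ with $\phi(X)=\mathbf 1\{\sum_m a_mf_m(X)>0\}$ and $\mathbf P_{m'}\{\sum_m a_mf_m(X)=0\}=0$ for every $m'$. The densities $f_0,\dots,f_{M-1}$ are linearly independent if $\mathbf P_{m'}\{\sum_ma_mf_m(X)=0\}=0$ for every $m'$ and every $(a_0,\dots,a_{M-1})$ not all zero. *)

theory Defs
  imports "HOL-Probability.Probability"
begin

text \<open>Raw observation X lives in the measure space N (the common sigma-finite
measure); f m is the density of X under state m; states are 0..M-1.
Binary sensor messages (l = 2) are represented by bool.\<close>

definition Pm :: "'a measure \<Rightarrow> (nat \<Rightarrow> 'a \<Rightarrow> real) \<Rightarrow> nat \<Rightarrow> 'a measure" where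
  "Pm N f m = density N (\<lambda>x. ennreal (f m x))"

definition det_quantizer :: "'a measure \<Rightarrow> ('a \<Rightarrow> bool) \<Rightarrow> bool" where
  "det_quantizer N \<phi> \<longleftrightarrow> \<phi> \<in> N \<rightarrow>\<^sub>M count_space UNIV"

definition rand_quantizer :: "'a measure \<Rightarrow> ('a \<Rightarrow> bool) pmf \<Rightarrow> bool" where
  "rand_quantizer N Q \<longleftrightarrow> (\<forall>\<phi>\<in>set_pmf Q. det_quantizer N \<phi>)"

definition qprob :: "'a measure \<Rightarrow> (nat \<Rightarrow> 'a \<Rightarrow> real) \<Rightarrow> nat \<Rightarrow> ('a \<Rightarrow> bool) \<Rightarrow> bool \<Rightarrow> real" where
  "qprob N f m \<phi> u = measure (Pm N f m) {x \<in> space N. \<phi> x = u}"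

definition klterm :: "real \<Rightarrow> real \<Rightarrow> real" where
  "klterm p q = (if p = 0 then 0 else p * ln (p / q))"

definition Idet :: "'a measure \<Rightarrow> (nat \<Rightarrow> 'a \<Rightarrow> real) \<Rightarrow> nat \<Rightarrow> nat \<Rightarrow> ('a \<Rightarrow> bool) \<Rightarrow> real" where
  "Idet N f m m' \<phi> = (\<Sum>u\<in>UNIV. klterm (qprob N f m \<phi> u) (qprob N f m' \<phi> u))"

definition Irand :: "'a measure \<Rightarrow> (nat \<Rightarrow> 'a \<Rightarrow> real) \<Rightarrow> nat \<Rightarrow> nat \<Rightarrow> ('a \<Rightarrow> bool) pmf \<Rightarrow> real" where
  "Irand N f m m' Q = measure_pmf.expectation Q (Idet N f m m')"

definition Imin :: "'a measure \<Rightarrow> (nat \<Rightarrow> 'a \<Rightarrow> real) \<Rightarrow> nat \<Rightarrow> nat \<Rightarrow> ('a \<Rightarrow> bool) pmf \<Rightarrow> real" where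
  "Imin N f M m Q = Min {Irand N f m m' Q | m'. m' < M \<and> m' \<noteq> m}"

definition Isup :: "'a measure \<Rightarrow> (nat \<Rightarrow> 'a \<Rightarrow> real) \<Rightarrow> nat \<Rightarrow> nat \<Rightarrow> real" where
  "Isup N f M m = (SUP Q \<in> {Q. rand_quantizer N Q}. Imin N f M m Q)"

definition maximin :: "'a measure \<Rightarrow> (nat \<Rightarrow> 'a \<Rightarrow> real) \<Rightarrow> nat \<Rightarrow> nat \<Rightarrow> ('a \<Rightarrow> bool) pmf \<Rightarrow> bool" where
  "maximin N f M m Q \<longleftrightarrow> rand_quantizer N Q \<and> Imin N f M m Q = Isup N f M m"

definition ULQ :: "'a measure \<Rightarrow> (nat \<Rightarrow> 'a \<Rightarrow> real) \<Rightarrow> nat \<Rightarrow> ('a \<Rightarrow> bool) \<Rightarrow> bool" where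
  "ULQ N f M \<phi> \<longleftrightarrow> det_quantizer N \<phi> \<and>
     (\<exists>a :: nat \<Rightarrow> real.
        (\<forall>x\<in>space N. \<phi> x = ((\<Sum>k<M. a k * f k x) > 0)) \<and>
        (\<forall>m'<M. emeasure (Pm N f m') {x \<in> space N. (\<Sum>k<M. a k * f k x) = 0} = 0))"

definition lin_indep_dens :: "'a measure \<Rightarrow> (nat \<Rightarrow> 'a \<Rightarrow> real) \<Rightarrow> nat \<Rightarrow> bool" where
  "lin_indep_dens N f M \<longleftrightarrow>
     (\<forall>a :: nat \<Rightarrow> real. (\<exists>k<M. a k \<noteq> 0) \<longrightarrow>
        (\<forall>m'<M. emeasure (Pm N f m') {x \<in> space N. (\<Sum>k<M. a k * f k x) = 0} = 0))"

end

theory Submission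
  imports Defs
begin

text \<open>
Replace a quantizer by a measurable \<^term>\<open>h\<close> with values in \<open>[0,1]\<close> and record the vector of its
expectations under the \<open>M\<close> states. The set of these vectors is convex, and it is closed: among the
functions whose vectors are close to a limit vector, those of almost minimal L2 norm converge.
The divergences are convex functions of the vector and continuous on this set: near the degenerate
points, the log-sum inequality bounds them by the integral of an integrable function against \<open>h\<close>.
A Caratheodory argument reduces any finite mixture to \<open>M - 1\<close> atoms without decreasing any of the
\<open>M - 1\<close> divergences, so compactness yields an optimal mixture of functions with values in \<open>[0,1]\<close>.
By convexity it remains to write each vector as a mixture of vectors of deterministic quantizers.
In general, a mixture with the given mean that maximizes the mean squared length has only
zero-one valued atoms. If the densities are linearly independent, the vectors of likelihood
quantizers form a compact set, and a nearest point of its convex hull coincides with the given vector,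
since the likelihood quantizer in the direction of the difference maximizes the linear functional.
\<close>

section \<open>Finite mixtures\<close>

text \<open>Gaussian elimination: an unknown with nonzero coefficient in the equation
  \<open>j0\<close> is substituted out of the other equations, which leaves one equation and one
  unknown fewer.\<close>

lemma homogeneous_system_nontrivial:
  fixes g :: "'j \<Rightarrow> 'i \<Rightarrow> real"
  assumes "finite J" "finite S" "card J < card S"
  shows "\<exists>c. (\<exists>i\<in>S. c i \<noteq> 0) \<and> (\<forall>j\<in>J. (\<Sum>i\<in>S. c i * g j i) = 0)"
  using assms
proof (induction J arbitrary: S g rule: finite_induct)
  case empty
  then obtain i where "i \<in> S" by fastforce
  then show ?case by (intro exI[of _ "\<lambda>_. 1"]) auto
next
  case (insert j0 J)
  show ?case
  proof (cases "\<forall>i\<in>S. g j0 i = 0")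
    case True
    have "card J < card S" using insert by simp
    from insert.IH[OF insert.prems(1) this] obtain c
      where "\<exists>i\<in>S. c i \<noteq> 0" "\<forall>j\<in>J. (\<Sum>i\<in>S. c i * g j i) = 0" by blast
    with True show ?thesis by (intro exI[of _ c]) auto
  next
    case False
    then obtain i0 where i0: "i0 \<in> S" "g j0 i0 \<noteq> 0" by blast
    define S' where "S' = S - {i0}"
    have S: "S = insert i0 S'" "i0 \<notin> S'" "finite S'"
      using i0 insert.prems(1) by (auto simp: S'_def)
    have "card J < card S'" using insert.prems(2) insert.hyps S by simp
    from insert.IH[OF S(3) this, of "\<lambda>j i. g j i - g j i0 * g j0 i / g j0 i0"] obtain c
      where c: "\<exists>i\<in>S'. c i \<noteq> 0"
        "\<forall>j\<in>J. (\<Sum>i\<in>S'. c i * (g j i - g j i0 * g j0 i / g j0 i0)) = 0"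
      by blast
    \<comment> \<open>The pivot value solves the equation \<open>j0\<close>; the corrected
      coefficients above are those that arise when it is inserted into the other equations.\<close>
    define c' where "c' = c(i0 := - (\<Sum>i\<in>S'. c i * g j0 i) / g j0 i0)"
    have c'0: "c' i0 = - (\<Sum>i\<in>S'. c i * g j0 i) / g j0 i0" by (simp add: c'_def)
    have sum: "(\<Sum>i\<in>S. c' i * h i) = c' i0 * h i0 + (\<Sum>i\<in>S'. c i * h i)" for h
    proof -
      have "(\<Sum>i\<in>S'. c' i * h i) = (\<Sum>i\<in>S'. c i * h i)"
        using S(2) by (intro sum.cong) (auto simp: c'_def)
      with S show ?thesis by simp
    qed
    have "(\<Sum>i\<in>S. c' i * g j i) = 0" if "j \<in> J" for j
    proof -
      have "(\<Sum>i\<in>S'. c i * (g j i - g j i0 * g j0 i / g j0 i0))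
          = (\<Sum>i\<in>S'. c i * g j i - (g j i0 / g j0 i0) * (c i * g j0 i))"
        by (intro sum.cong) (auto simp: algebra_simps)
      also have "\<dots> = (\<Sum>i\<in>S'. c i * g j i) - (g j i0 / g j0 i0) * (\<Sum>i\<in>S'. c i * g j0 i)"
        by (simp add: sum_subtractf sum_distrib_left)
      finally show ?thesis using c(2) that unfolding sum c'0 by simp
    qed
    moreover have "(\<Sum>i\<in>S. c' i * g j0 i) = 0"
      using i0 unfolding sum c'0 by simp
    moreover have "\<exists>i\<in>S. c' i \<noteq> 0"
      using c(1) S by (auto simp: c'_def)
    ultimately show ?thesis by (intro exI[of _ c']) auto
  qed
qed

text \<open>
Moving the weights along a kernel vector of the constraints, oriented so that the sum of \<open>\<psi>\<close>
does not decrease, until a weight vanishes removes an atom.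
\<close>

lemma caratheodory_weights:
  fixes g :: "'j \<Rightarrow> 'i \<Rightarrow> real" and \<psi> :: "'i \<Rightarrow> real"
  assumes "finite J" "finite S" "\<And>i. i \<in> S \<Longrightarrow> 0 \<le> w i"
  shows "\<exists>T w'. T \<subseteq> S \<and> card T \<le> card J + 1 \<and> (\<forall>i\<in>T. 0 \<le> w' i) \<and>
     sum w' T = sum w S \<and> (\<forall>j\<in>J. (\<Sum>i\<in>T. w' i * g j i) = (\<Sum>i\<in>S. w i * g j i)) \<and>
     (\<Sum>i\<in>S. w i * \<psi> i) \<le> (\<Sum>i\<in>T. w' i * \<psi> i)"
  using assms(2,3)
proof (induction "card S" arbitrary: S w rule: less_induct)
  case less
  show ?case
  proof (cases "card S \<le> card J + 1")
    case True
    with less.prems show ?thesis by (intro exI[of _ S] exI[of _ w]) auto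
  next
    case False
    \<comment> \<open>The additional row \<open>None\<close> makes the kernel vector sum to zero, so
      that moving along it preserves the total weight.\<close>
    define G where "G = case_option (\<lambda>_. 1) g"
    have "card (insert None (Some ` J)) < card S"
      using False assms(1) by (simp add: card_image)
    from homogeneous_system_nontrivial[OF _ less.prems(1) this, of G] assms(1) obtain c0
      where c0: "\<exists>i\<in>S. c0 i \<noteq> 0" "\<forall>j\<in>insert None (Some ` J). (\<Sum>i\<in>S. c0 i * G j i) = 0"
      by blast
    define s :: real where "s = (if 0 \<le> (\<Sum>i\<in>S. c0 i * \<psi> i) then 1 else -1)"
    define c where "c i = s * c0 i" for i
    have csum: "(\<Sum>i\<in>S. c i * h i) = s * (\<Sum>i\<in>S. c0 i * h i)" for h
      by (simp add: c_def sum_distrib_left mult.assoc)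
    have c\<psi>: "0 \<le> (\<Sum>i\<in>S. c i * \<psi> i)"
      by (simp add: csum s_def)
    have cg: "(\<Sum>i\<in>S. c i * g j i) = 0" if "j \<in> J" for j
      using c0(2) that csum[of "g j"] by (auto simp: G_def)
    have c1: "(\<Sum>i\<in>S. c i) = 0"
      using c0(2) csum[of "\<lambda>_. 1"] by (auto simp: G_def)
    have "\<exists>i\<in>S. c i \<noteq> 0" using c0(1) by (auto simp: c_def s_def)
    then have "\<exists>i\<in>S. c i < 0"
      using c1 sum_nonneg_eq_0_iff[OF less.prems(1), of c] by (meson not_less)
    define A where "A = (\<lambda>i. w i / - c i) ` {i\<in>S. c i < 0}"
    have A: "finite A" "A \<noteq> {}" using less.prems(1) \<open>\<exists>i\<in>S. c i < 0\<close> by (auto simp: A_def)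
    \<comment> \<open>The longest step along \<open>c\<close> that keeps all weights nonnegative;
      the index attaining the minimum is the atom that vanishes.\<close>
    define l where "l = Min A"
    have "l \<in> A" using A by (simp add: l_def)
    then obtain i0 where i0: "i0 \<in> S" "c i0 < 0" "l = w i0 / - c i0" by (auto simp: A_def)
    have l0: "0 \<le> l" using i0 less.prems(2)[of i0] by (simp add: divide_nonneg_neg flip: minus_divide_right)
    define w1 where "w1 i = w i + l * c i" for i
    have w10: "w1 i0 = 0" using i0 by (simp add: w1_def)
    have w1: "0 \<le> w1 i" if "i \<in> S" for i
    proof (cases "c i < 0")
      case True
      then have "l \<le> w i / - c i" using A that unfolding l_def by (intro Min_le) (auto simp: A_def)
      with True have "l * (- c i) \<le> w i" by (subst (asm) pos_le_divide_eq) auto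
      then show ?thesis by (simp add: w1_def)
    next
      case False
      then show ?thesis using l0 less.prems(2)[OF that] by (simp add: w1_def)
    qed
    have w1sum: "(\<Sum>i\<in>S - {i0}. w1 i * h i) = (\<Sum>i\<in>S. w i * h i) + l * (\<Sum>i\<in>S. c i * h i)" for h
    proof -
      have "(\<Sum>i\<in>S. w1 i * h i) = (\<Sum>i\<in>S - {i0}. w1 i * h i)"
        using i0 less.prems(1) w10 by (simp add: sum.remove)
      moreover have "(\<Sum>i\<in>S. w1 i * h i) = (\<Sum>i\<in>S. w i * h i) + l * (\<Sum>i\<in>S. c i * h i)"
        by (simp add: w1_def sum.distrib sum_distrib_left algebra_simps)
      ultimately show ?thesis by simp
    qed
    have "card (S - {i0}) < card S" using i0 less.prems(1) by (intro psubset_card_mono) auto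
    from less.hyps[OF this, of w1] obtain T w' where T: "T \<subseteq> S - {i0}" "card T \<le> card J + 1"
      "\<forall>i\<in>T. 0 \<le> w' i" "sum w' T = sum w1 (S - {i0})"
      "\<forall>j\<in>J. (\<Sum>i\<in>T. w' i * g j i) = (\<Sum>i\<in>S - {i0}. w1 i * g j i)"
      "(\<Sum>i\<in>S - {i0}. w1 i * \<psi> i) \<le> (\<Sum>i\<in>T. w' i * \<psi> i)"
      using w1 less.prems(1) by auto
    have "sum w1 (S - {i0}) = sum w S" using w1sum[of "\<lambda>_. 1"] c1 by simp
    moreover have "(\<Sum>i\<in>S. w i * \<psi> i) \<le> (\<Sum>i\<in>T. w' i * \<psi> i)"
      using T(6) w1sum[of \<psi>] mult_nonneg_nonneg[OF l0 c\<psi>] by linarith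
    ultimately show ?thesis using T cg
      by (intro exI[of _ T] exI[of _ w']) (auto simp: w1sum)
  qed
qed

text \<open>Repetitions and zero weights are allowed, so combinations of fewer than \<open>R\<close>
  points are included. Fixing the number of atoms makes compactness immediate; the place of
  convexity is taken by Caratheodory reductions.\<close>

definition mixtures :: "nat \<Rightarrow> (nat \<Rightarrow> real) set \<Rightarrow> (nat \<Rightarrow> real) set" where
  "mixtures R K = {\<lambda>k. \<Sum>i<R. t i * z i k | t z.
     (\<forall>i<R. 0 \<le> t i \<and> z i \<in> K) \<and> (\<Sum>i<R. t i) = 1}"

lemma mixturesE:
  assumes "v \<in> mixtures R K"
  obtains t z where "v = (\<lambda>k. \<Sum>i<R. t i * z i k)" "\<And>i. i < R \<Longrightarrow> 0 \<le> t i"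
    "\<And>i. i < R \<Longrightarrow> z i \<in> K" "(\<Sum>i<R. t i) = 1"
  using assms unfolding mixtures_def by blast

lemma finite_mixture_in_mixtures:
  assumes "finite T" "card T \<le> R" "\<And>i. i \<in> T \<Longrightarrow> 0 \<le> w i" "\<And>i. i \<in> T \<Longrightarrow> z i \<in> K" "sum w T = 1"
  shows "(\<lambda>k. \<Sum>i\<in>T. w i * z i k) \<in> mixtures R K"
proof -
  have "T \<noteq> {}" using assms(5) by auto
  then obtain i0 where i0: "i0 \<in> T" by blast
  obtain e where e: "bij_betw e {..<card T} T"
    using ex_bij_betw_nat_finite[OF assms(1)] by (auto simp: atLeast0LessThan)
  have eT: "e i \<in> T" if "i < card T" for i using e that by (auto simp: bij_betw_def)
  define t' where "t' i = (if i < card T then w (e i) else 0)" for i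
  \<comment> \<open>Padded indices carry weight zero but must still point into \<open>K\<close>,
    hence the fallback \<open>z i0\<close>.\<close>
  define z' where "z' i = (if i < card T then z (e i) else z i0)" for i
  have *: "(\<Sum>i<R. t' i * h (z' i)) = (\<Sum>i\<in>T. w i * h (z i))" for h :: "(nat \<Rightarrow> real) \<Rightarrow> real"
  proof -
    have "(\<Sum>i<R. t' i * h (z' i)) = (\<Sum>i<card T. t' i * h (z' i))"
      using assms(2) by (intro sum.mono_neutral_right) (auto simp: t'_def)
    also have "\<dots> = (\<Sum>i<card T. w (e i) * h (z (e i)))"
      by (intro sum.cong) (auto simp: t'_def z'_def)
    also have "\<dots> = (\<Sum>i\<in>T. w i * h (z i))"
      by (rule sum.reindex_bij_betw[OF e])
    finally show ?thesis .
  qed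
  have "(\<Sum>i<R. t' i) = 1" using *[of "\<lambda>_. 1"] assms(5) by simp
  moreover have "(\<lambda>k. \<Sum>i\<in>T. w i * z i k) = (\<lambda>k. \<Sum>i<R. t' i * z' i k)"
    by (intro ext) (rule *[symmetric])
  moreover have "\<forall>i<R. 0 \<le> t' i \<and> z' i \<in> K"
    using assms(3,4) i0 eT by (auto simp: t'_def z'_def)
  ultimately show ?thesis unfolding mixtures_def by blast
qed

text \<open>The coordinates in \<open>J\<close> play the role of the prescribed mean, and
  \<open>l\<close> that of an objective to be maximized under this mean.\<close>

lemma caratheodory_mixture:
  assumes "finite J" "card J + 1 \<le> R" "finite S" "\<And>i. i \<in> S \<Longrightarrow> 0 \<le> w i" "sum w S = 1"
    and "\<And>i. i \<in> S \<Longrightarrow> z i \<in> K"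
  shows "\<exists>v\<in>mixtures R K. (\<forall>j\<in>J. v j = (\<Sum>i\<in>S. w i * z i j)) \<and> (\<Sum>i\<in>S. w i * z i l) \<le> v l"
proof -
  have "\<exists>T w'. T \<subseteq> S \<and> card T \<le> card J + 1 \<and> (\<forall>i\<in>T. 0 \<le> w' i) \<and>
     sum w' T = sum w S \<and> (\<forall>j\<in>J. (\<Sum>i\<in>T. w' i * z i j) = (\<Sum>i\<in>S. w i * z i j)) \<and>
     (\<Sum>i\<in>S. w i * z i l) \<le> (\<Sum>i\<in>T. w' i * z i l)"
    by (rule caratheodory_weights) (use assms in auto)
  then obtain T w'
    where T: "T \<subseteq> S" "card T \<le> card J + 1" "\<forall>i\<in>T. 0 \<le> w' i" "sum w' T = sum w S"
      "\<forall>j\<in>J. (\<Sum>i\<in>T. w' i * z i j) = (\<Sum>i\<in>S. w i * z i j)"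
      "(\<Sum>i\<in>S. w i * z i l) \<le> (\<Sum>i\<in>T. w' i * z i l)" by blast
  have "(\<lambda>k. \<Sum>i\<in>T. w' i * z i k) \<in> mixtures R K"
    using T assms by (intro finite_mixture_in_mixtures) (auto intro: finite_subset)
  with T show ?thesis
    by (intro bexI[of _ "\<lambda>k. \<Sum>i\<in>T. w' i * z i k"]) auto
qed

text \<open>The source of the bound \<open>M - 1\<close>: with \<open>J\<close> the set of the
  \<open>M - 1\<close> alternatives to a state, a mixture of divergence vectors is thinned to that
  many atoms and no divergence drops. If one coordinate does not drop and its differences to the
  others are kept, then none drops.\<close>

lemma caratheodory_dominating:
  fixes z :: "'i \<Rightarrow> nat \<Rightarrow> real"
  assumes "finite J" "J \<noteq> {}" "card J \<le> R" "finite S" "\<And>i. i \<in> S \<Longrightarrow> 0 \<le> w i" "sum w S = 1"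
    and "\<And>i. i \<in> S \<Longrightarrow> z i \<in> K"
  shows "\<exists>v\<in>mixtures R K. \<forall>j\<in>J. (\<Sum>i\<in>S. w i * z i j) \<le> v j"
proof -
  from assms(2) obtain l where l: "l \<in> J" by blast
  \<comment> \<open>Preserving only the differences to the coordinate \<open>l\<close> saves one atom.\<close>
  have "\<exists>T w'. T \<subseteq> S \<and> card T \<le> card (J - {l}) + 1 \<and> (\<forall>i\<in>T. 0 \<le> w' i) \<and> sum w' T = sum w S \<and>
     (\<forall>j\<in>J - {l}. (\<Sum>i\<in>T. w' i * (z i j - z i l)) = (\<Sum>i\<in>S. w i * (z i j - z i l))) \<and>
     (\<Sum>i\<in>S. w i * z i l) \<le> (\<Sum>i\<in>T. w' i * z i l)"
    by (rule caratheodory_weights) (use assms in auto)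
  then obtain T w' where T: "T \<subseteq> S" "card T \<le> card (J - {l}) + 1" "\<forall>i\<in>T. 0 \<le> w' i"
    "sum w' T = sum w S"
    "\<forall>j\<in>J - {l}. (\<Sum>i\<in>T. w' i * (z i j - z i l)) = (\<Sum>i\<in>S. w i * (z i j - z i l))"
    "(\<Sum>i\<in>S. w i * z i l) \<le> (\<Sum>i\<in>T. w' i * z i l)" by blast
  have "card T \<le> R" using T(2) card.remove[OF assms(1) l] assms(3) by simp
  then have "(\<lambda>k. \<Sum>i\<in>T. w' i * z i k) \<in> mixtures R K"
    using T assms by (intro finite_mixture_in_mixtures) (auto intro: finite_subset)
  moreover have "(\<Sum>i\<in>S. w i * z i j) \<le> (\<Sum>i\<in>T. w' i * z i j)" if "j \<in> J" for j
  proof (cases "j = l")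
    case False
    with T(5) that have "(\<Sum>i\<in>T. w' i * z i j) - (\<Sum>i\<in>T. w' i * z i l) = (\<Sum>i\<in>S. w i * z i j) - (\<Sum>i\<in>S. w i * z i l)"
      by (simp add: right_diff_distrib sum_subtractf)
    with T(6) show ?thesis by linarith
  qed (use T(6) in simp)
  ultimately show ?thesis by (intro bexI[of _ "\<lambda>k. \<Sum>i\<in>T. w' i * z i k"]) auto
qed

section \<open>Compactness in the product topology\<close>

lemma tendsto_fun_coordinate:
  fixes u :: "nat \<Rightarrow> nat \<Rightarrow> real"
  assumes "u \<longlonglongrightarrow> v"
  shows "(\<lambda>n. u n k) \<longlonglongrightarrow> v k"
proof -
  have "isCont (\<lambda>w :: nat \<Rightarrow> real. w k) v"
    using continuous_on_product_coordinates[of k] continuous_on_eq_continuous_at[OF open_UNIV] by blast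
  then show ?thesis using assms by (rule isCont_tendsto_compose)
qed

lemma compact_Pi_UNIV:
  fixes K :: "'b::topological_space set"
  assumes "compact K"
  shows "compact {z :: 'a \<Rightarrow> 'b. \<forall>i. z i \<in> K}"
proof -
  have "{z :: 'a \<Rightarrow> 'b. \<forall>i. z i \<in> K} = PiE UNIV (\<lambda>_. K)" by auto
  moreover have "compactin (product_topology (\<lambda>_. euclidean) UNIV) (PiE (UNIV::'a set) (\<lambda>_. K))"
    using assms by (subst compactin_PiE) auto
  ultimately show ?thesis
    by (simp add: euclidean_product_topology compactin_euclidean_iff)
qed

text \<open>By Tychonoff the weights and the families of points form compact sets, and mixing is
  continuous in both.\<close>

lemma compact_mixtures:
  assumes "compact K"
  shows "compact (mixtures R K)"
proof -
  define T where "T = {t :: nat \<Rightarrow> real. \<forall>i. t i \<in> {0..1}} \<inter> {t. (\<Sum>i<R. t i) = 1}"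
  define Z where "Z = {z :: nat \<Rightarrow> nat \<Rightarrow> real. \<forall>i. z i \<in> K}"
  define F where "F = (\<lambda>(t, z) k. \<Sum>i<R. (t i :: real) * (z :: nat \<Rightarrow> nat \<Rightarrow> real) i k)"
  have "closed {t :: nat \<Rightarrow> real. (\<Sum>i<R. t i) = 1}"
    by (intro closed_Collect_eq continuous_intros) auto
  then have "compact T"
    unfolding T_def by (intro compact_Int_closed compact_Pi_UNIV) auto
  moreover have "compact Z" unfolding Z_def using assms by (rule compact_Pi_UNIV)
  moreover have "continuous_on (T \<times> Z) F"
  proof -
    have 1: "continuous_on UNIV (\<lambda>p :: (nat \<Rightarrow> real) \<times> (nat \<Rightarrow> nat \<Rightarrow> real). fst p i)" for i
      by (rule continuous_on_product_then_coordinatewise) (rule continuous_on_fst[OF continuous_on_id])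
    have 2: "continuous_on UNIV (\<lambda>p :: (nat \<Rightarrow> real) \<times> (nat \<Rightarrow> nat \<Rightarrow> real). snd p i k)" for i k
      by (rule continuous_on_product_then_coordinatewise, rule continuous_on_product_then_coordinatewise)
        (rule continuous_on_snd[OF continuous_on_id])
    have "continuous_on UNIV F"
      unfolding F_def case_prod_beta
      by (intro continuous_on_coordinatewise_then_product continuous_on_sum continuous_on_mult 1 2)
    then show ?thesis by (rule continuous_on_subset) auto
  qed
  ultimately have "compact (F ` (T \<times> Z))"
    by (intro compact_continuous_image compact_Times)
  also have "F ` (T \<times> Z) = mixtures R K"
  proof (intro equalityI subsetI)
    fix v assume "v \<in> F ` (T \<times> Z)"
    then show "v \<in> mixtures R K"
      unfolding mixtures_def F_def T_def Z_def by auto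
  next
    fix v assume "v \<in> mixtures R K"
    then obtain t z where v: "v = (\<lambda>k. \<Sum>i<R. t i * z i k)" "\<And>i. i < R \<Longrightarrow> 0 \<le> t i"
      "\<And>i. i < R \<Longrightarrow> z i \<in> K" "(\<Sum>i<R. t i) = 1" by (auto elim!: mixturesE)
    then have "0 < R" by (cases R) auto
    have "t i \<le> 1" if "i < R" for i
      using member_le_sum[of i "{..<R}" t] v that by auto
    \<comment> \<open>The parameters are total functions constrained at every index, so the values
      from \<open>R\<close> on have to be reset to admissible ones.\<close>
    then have "(\<lambda>i. if i < R then t i else 0, \<lambda>i. if i < R then z i else z 0) \<in> T \<times> Z"
      using v \<open>0 < R\<close> by (auto simp: T_def Z_def)
    moreover have "v = F (\<lambda>i. if i < R then t i else 0, \<lambda>i. if i < R then z i else z 0)"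
      by (auto simp: v F_def)
    ultimately show "v \<in> F ` (T \<times> Z)" by blast
  qed
  finally show ?thesis .
qed

section \<open>Finite truncation and construction of probability mass functions\<close>

lemma pmf_finite_support_approx:
  assumes "0 < e"
  shows "\<exists>S\<subseteq>set_pmf p. finite S \<and> 1 - e < sum (pmf p) S"
proof -
  have "pmf p summable_on UNIV"
    by (rule abs_summable_summable[OF iffD2[OF abs_summable_equivalent pmf_abs_summable]])
  moreover have "infsum (pmf p) UNIV = 1"
    using infsetsum_pmf_eq_1[of p UNIV] infsetsum_infsum[OF pmf_abs_summable, of p UNIV] by simp
  ultimately have "(pmf p has_sum 1) UNIV" by (metis has_sum_infsum)
  then have "(sum (pmf p) \<longlongrightarrow> 1) (finite_subsets_at_top UNIV)" by (simp add: has_sum_def)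
  then have "\<forall>\<^sub>F S in finite_subsets_at_top UNIV. 1 - e < sum (pmf p) S"
    by (rule order_tendstoD) (use assms in auto)
  then obtain S where S: "finite S" "1 - e < sum (pmf p) S"
    unfolding eventually_finite_subsets_at_top by auto
  moreover have "sum (pmf p) (S \<inter> set_pmf p) = sum (pmf p) S"
    using S by (intro sum.mono_neutral_left) (auto simp: set_pmf_iff)
  ultimately show ?thesis by (intro exI[of _ "S \<inter> set_pmf p"]) auto
qed

lemma ex_pmf_with_weights:
  fixes R :: nat
  assumes "\<And>i. i < R \<Longrightarrow> 0 \<le> t i" "(\<Sum>i<R. t i) = (1 :: real)"
  shows "\<exists>p. set_pmf p \<subseteq> {..<R} \<and> (\<forall>i<R. pmf p i = t i)"
proof -
  define g where "g i = (if i < R then t i else 0)" for i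
  have "(\<integral>\<^sup>+i. ennreal (g i) \<partial>count_space UNIV) = (\<Sum>i<R. ennreal (g i))"
    by (rule nn_integral_count_space') (auto simp: g_def)
  also have "\<dots> = ennreal (\<Sum>i<R. g i)" using assms(1) by (intro sum_ennreal) (auto simp: g_def)
  also have "(\<Sum>i<R. g i) = 1" using assms(2) by (simp add: g_def)
  finally have "(\<integral>\<^sup>+i. ennreal (g i) \<partial>count_space UNIV) = 1" by simp
  moreover have "0 \<le> g i" for i using assms(1) by (simp add: g_def)
  ultimately show ?thesis
    by (intro exI[of _ "embed_pmf g"]) (auto simp: pmf_embed_pmf set_embed_pmf g_def split: if_splits)
qed

section \<open>Divergences of randomized tests\<close>

text \<open>This is \<open>ln y \<le> y - 1\<close> at \<open>y = c * q / p\<close>. The left side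
  is linear in \<open>(p, q)\<close> and, for positive arguments, is attained at
  \<open>c = p / q\<close>, so it is a tangent plane of \<open>klterm\<close>. Summed or integrated,
  these planes give every convexity estimate below.\<close>

lemma klterm_ge_tangent:
  assumes "0 \<le> p" "0 \<le> q" "q = 0 \<Longrightarrow> p = 0" "0 < c"
  shows "p * (ln c + 1) - c * q \<le> klterm p q"
proof (cases "p = 0")
  case True
  with assms show ?thesis by (simp add: klterm_def)
next
  case False
  then have "q \<noteq> 0" using assms(3) by blast
  with False assms(1,2) have pq: "0 < p" "0 < q" by auto
  have "ln (c * q / p) \<le> c * q / p - 1"
    using assms pq by (intro ln_le_minus_one) auto
  moreover have "ln (c * q / p) = ln c - ln (p / q)"
    using assms pq by (simp add: ln_mult ln_div)
  ultimately have "p * (ln c - ln (p / q)) \<le> p * (c * q / p - 1)"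
    using pq by (intro mult_left_mono) auto
  then show ?thesis using pq by (simp add: klterm_def algebra_simps)
qed

lemma klterm_eq_tangent:
  assumes "0 < p" "0 < q"
  shows "klterm p q = p * (ln (p / q) + 1) - (p / q) * q"
  using assms by (simp add: klterm_def algebra_simps)

text \<open>The log-sum inequality: the tangent planes with one common slope \<open>c\<close> are
  summed, and \<open>c\<close> is then chosen as the quotient of the two totals. The last hypothesis
  excludes pairs whose true divergence is infinite while \<open>klterm\<close> returns a finite
  value.\<close>

lemma klterm_sum_le:
  assumes "finite S" "\<And>i. i \<in> S \<Longrightarrow> 0 \<le> w i" "\<And>i. i \<in> S \<Longrightarrow> 0 \<le> p i" "\<And>i. i \<in> S \<Longrightarrow> 0 \<le> q i"
    and "\<And>i. i \<in> S \<Longrightarrow> q i = 0 \<Longrightarrow> p i = 0"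
  shows "klterm (\<Sum>i\<in>S. w i * p i) (\<Sum>i\<in>S. w i * q i) \<le> (\<Sum>i\<in>S. w i * klterm (p i) (q i))"
proof -
  define P where "P = (\<Sum>i\<in>S. w i * p i)"
  define Q where "Q = (\<Sum>i\<in>S. w i * q i)"
  have nn: "0 \<le> w i * p i" "0 \<le> w i * q i" if "i \<in> S" for i
    using assms(2-4)[OF that] by auto
  have P0: "0 \<le> P" and Q0: "0 \<le> Q" unfolding P_def Q_def using nn by (auto intro!: sum_nonneg)
  have bound: "P * (ln c + 1) - c * Q \<le> (\<Sum>i\<in>S. w i * klterm (p i) (q i))" if "0 < c" for c
  proof -
    have "P * (ln c + 1) - c * Q = (\<Sum>i\<in>S. w i * (p i * (ln c + 1) - c * q i))"
      unfolding P_def Q_def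
      by (simp add: sum_distrib_left sum_distrib_right algebra_simps sum_subtractf sum.distrib)
    also have "\<dots> \<le> (\<Sum>i\<in>S. w i * klterm (p i) (q i))"
      using assms that by (intro sum_mono mult_left_mono klterm_ge_tangent) auto
    finally show ?thesis .
  qed
  show ?thesis
  proof (cases "P = 0")
    case True
    then have "\<forall>i\<in>S. w i * p i = 0"
      unfolding P_def using nn assms(1) by (subst (asm) sum_nonneg_eq_0_iff) auto
    then have "(\<Sum>i\<in>S. w i * klterm (p i) (q i)) = 0"
      by (intro sum.neutral) (auto simp: klterm_def)
    with True show ?thesis by (simp add: klterm_def flip: P_def)
  next
    case False
    have "Q \<noteq> 0"
    proof
      assume "Q = 0"
      then have "\<forall>i\<in>S. w i * q i = 0"
        unfolding Q_def using nn assms(1) by (subst (asm) sum_nonneg_eq_0_iff) auto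
      then have "P = 0" unfolding P_def using assms(5) by (intro sum.neutral) auto
      with False show False by simp
    qed
    with False P0 Q0 have "0 < P" "0 < Q" by auto
    with bound[of "P / Q"] show ?thesis
      by (simp add: klterm_eq_tangent flip: P_def Q_def)
  qed
qed

section \<open>Mutually absolutely continuous states and their randomized tests\<close>

locale quantization =
  fixes N :: "'a measure" and f :: "nat \<Rightarrow> 'a \<Rightarrow> real" and M :: nat
  assumes f_measurable [measurable]: "\<And>k. k < M \<Longrightarrow> f k \<in> borel_measurable N"
    and f_nonneg: "\<And>k x. k < M \<Longrightarrow> x \<in> space N \<Longrightarrow> 0 \<le> f k x"
    and prob: "\<And>k. k < M \<Longrightarrow> prob_space (Pm N f k)"
    and AE_pos: "\<And>k l. k < M \<Longrightarrow> l < M \<Longrightarrow> k \<noteq> l \<Longrightarrow> AE x in Pm N f k. 0 < f l x"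
    and llr_integrable: "\<And>k l. k < M \<Longrightarrow> l < M \<Longrightarrow> k \<noteq> l \<Longrightarrow>
      integrable (Pm N f k) (\<lambda>x. ln (f k x / f l x))"
begin

lemma AE_f_nonneg: "k < M \<Longrightarrow> AE x in N. 0 \<le> f k x"
  using f_nonneg by auto

lemma f_integrable: "k < M \<Longrightarrow> integrable N (f k)"
proof -
  assume k: "k < M"
  interpret P: prob_space "density N (f k)" using prob[OF k] by (simp add: Pm_def)
  have "integrable (density N (f k)) (\<lambda>_. 1 :: real)" by simp
  then show ?thesis using k AE_f_nonneg by (subst (asm) integrable_density) auto
qed

lemma f_integral: "k < M \<Longrightarrow> (\<integral>x. f k x \<partial>N) = 1"
proof -
  assume k: "k < M"
  interpret P: prob_space "density N (f k)" using prob[OF k] by (simp add: Pm_def)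
  have "(\<integral>x. 1 \<partial>density N (f k)) = (1 :: real)" using P.prob_space by simp
  then show ?thesis using k AE_f_nonneg by (subst (asm) integral_density) auto
qed

lemma AE_f_pos: "k < M \<Longrightarrow> l < M \<Longrightarrow> AE x in N. 0 < f k x \<longrightarrow> 0 < f l x"
proof (cases "k = l")
  case False
  assume "k < M" "l < M"
  with AE_pos[OF this False] show ?thesis
    unfolding Pm_def by (subst (asm) AE_density) auto
qed auto

lemma kl_integrable: "k < M \<Longrightarrow> l < M \<Longrightarrow> k \<noteq> l \<Longrightarrow> integrable N (\<lambda>x. f k x * ln (f k x / f l x))"
  using llr_integrable[of k l] AE_f_nonneg[of k] unfolding Pm_def
  by (subst (asm) integrable_density) auto

text \<open>\<open>pv h\<close> vanishes beyond \<open>M\<close>, so that it is determined by its first \<open>M\<close> coordinates.\<close>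

definition fuzzy :: "('a \<Rightarrow> real) set" where
  "fuzzy = {h \<in> borel_measurable N. \<forall>x\<in>space N. 0 \<le> h x \<and> h x \<le> 1}"

definition pv :: "('a \<Rightarrow> real) \<Rightarrow> nat \<Rightarrow> real" where
  "pv h k = (if k < M then \<integral>x. h x * f k x \<partial>N else 0)"

lemma fuzzy_measurable: "h \<in> fuzzy \<Longrightarrow> h \<in> borel_measurable N"
  by (simp add: fuzzy_def)

lemma fuzzy_bounds: "h \<in> fuzzy \<Longrightarrow> x \<in> space N \<Longrightarrow> 0 \<le> h x" "h \<in> fuzzy \<Longrightarrow> x \<in> space N \<Longrightarrow> h x \<le> 1"
  by (auto simp: fuzzy_def)

lemma fuzzy_compl: "h \<in> fuzzy \<Longrightarrow> (\<lambda>x. 1 - h x) \<in> fuzzy"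
  by (auto simp: fuzzy_def)

lemma fuzzy_mult_integrable:
  assumes "h \<in> fuzzy" "integrable N g"
  shows "integrable N (\<lambda>x. h x * g x)"
proof (rule Bochner_Integration.integrable_bound[OF assms(2)])
  show "(\<lambda>x. h x * g x) \<in> borel_measurable N"
    using assms by (auto simp: fuzzy_def)
  show "AE x in N. norm (h x * g x) \<le> norm (g x)"
    using assms by (auto simp: fuzzy_def abs_mult mult_left_le_one_le)
qed

lemma pv_integrable: "h \<in> fuzzy \<Longrightarrow> k < M \<Longrightarrow> integrable N (\<lambda>x. h x * f k x)"
  by (rule fuzzy_mult_integrable[OF _ f_integrable])

lemma pv_compl: "h \<in> fuzzy \<Longrightarrow> k < M \<Longrightarrow> pv (\<lambda>x. 1 - h x) k = 1 - pv h k"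
  using f_integral[of k] f_integrable[of k] pv_integrable[of h k]
  by (simp add: pv_def left_diff_distrib)

lemma pv_nonneg: "h \<in> fuzzy \<Longrightarrow> 0 \<le> pv h k"
  using AE_f_nonneg[of k] unfolding pv_def
  by (auto intro!: integral_nonneg_AE elim!: AE_mp simp: fuzzy_bounds f_nonneg)

lemma pv_le_1: "h \<in> fuzzy \<Longrightarrow> pv h k \<le> 1"
  using pv_nonneg[OF fuzzy_compl, of h k] pv_compl[of h k] by (cases "k < M") (auto simp: pv_def)

text \<open>A test that vanishes almost surely in one state does so in every state, by mutual
  absolute continuity. Hence the coordinates below \<open>M\<close> of an achievable vector vanish
  only together, which is the side condition of the log-sum inequality.\<close>

lemma pv_eq_0: 
  assumes "h \<in> fuzzy" "k < M" "l < M" "pv h k = 0"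
  shows "pv h l = 0"
proof -
  have "AE x in N. 0 \<le> h x * f k x" using assms by (auto simp: fuzzy_bounds f_nonneg)
  then have "AE x in N. h x * f k x = 0"
    using assms integral_nonneg_eq_0_iff_AE[OF pv_integrable[OF assms(1,2)]] by (simp add: pv_def)
  with AE_f_pos[OF assms(3,2)] have "AE x in N. h x * f l x = 0"
    using AE_f_nonneg[OF assms(3)] AE_f_nonneg[OF assms(2)] by eventually_elim force
  then show ?thesis by (simp add: pv_def integral_eq_zero_AE)
qed

text \<open>The log-sum inequality in integral form: the tangent bound with slope
  \<open>pv h k / pv h l\<close> is integrated pointwise against \<open>h\<close>. The absolute
  value makes the bound monotone in \<open>h\<close>, and it keeps \<open>h\<close> inside the
  integral so that the bound becomes small as the test degenerates.\<close>

lemma klterm_pv_le: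
  assumes h: "h \<in> fuzzy" and kl: "k < M" "l < M" "k \<noteq> l"
  shows "klterm (pv h k) (pv h l) \<le> (\<integral>x. h x * \<bar>f k x * ln (f k x / f l x)\<bar> \<partial>N)"
proof (cases "pv h k = 0")
  case True
  have "0 \<le> (\<integral>x. h x * \<bar>f k x * ln (f k x / f l x)\<bar> \<partial>N)"
    using h by (intro integral_nonneg_AE) (auto simp: fuzzy_bounds)
  with True show ?thesis by (simp add: klterm_def)
next
  case False
  with pv_eq_0[OF h kl(2,1)] have "pv h l \<noteq> 0" by auto
  with False pv_nonneg[OF h] have pos: "0 < pv h k" "0 < pv h l" by (auto simp: order.strict_iff_order)
  define c where "c = pv h k / pv h l"
  have c: "0 < c" using pos by (simp add: c_def)
  have int: "integrable N (\<lambda>x. h x * f k x)" "integrable N (\<lambda>x. h x * f l x)"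
    "integrable N (\<lambda>x. h x * \<bar>f k x * ln (f k x / f l x)\<bar>)"
    using pv_integrable[OF h kl(1)] pv_integrable[OF h kl(2)]
      fuzzy_mult_integrable[OF h integrable_abs[OF kl_integrable[OF kl]]] by auto
  have "klterm (pv h k) (pv h l) = (ln c + 1) * pv h k - c * pv h l"
    unfolding klterm_eq_tangent[OF pos] c_def by (simp add: mult.commute)
  also have "\<dots> = (\<integral>x. (ln c + 1) * (h x * f k x) - c * (h x * f l x) \<partial>N)"
    using int kl by (simp add: pv_def)
  also have "\<dots> \<le> (\<integral>x. h x * \<bar>f k x * ln (f k x / f l x)\<bar> \<partial>N)"
  proof (rule integral_mono_AE)
    show "AE x in N. (ln c + 1) * (h x * f k x) - c * (h x * f l x) \<le> h x * \<bar>f k x * ln (f k x / f l x)\<bar>"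
      using AE_f_pos[OF kl(1,2)] AE_space
    proof eventually_elim
      case (elim x)
      have nn: "0 \<le> f k x" "0 \<le> f l x" "0 \<le> h x" using elim kl h f_nonneg fuzzy_bounds by auto
      have "f k x * (ln c + 1) - c * f l x \<le> klterm (f k x) (f l x)"
        using nn elim c by (intro klterm_ge_tangent) auto
      also have "\<dots> \<le> \<bar>f k x * ln (f k x / f l x)\<bar>"
        by (cases "f k x = 0") (simp_all add: klterm_def abs_ge_self del: abs_mult)
      finally have "h x * (f k x * (ln c + 1) - c * f l x) \<le> h x * \<bar>f k x * ln (f k x / f l x)\<bar>"
        using nn by (intro mult_left_mono)
      then show ?case by (simp add: algebra_simps)
    qed
  qed (use int in auto)
  finally show ?thesis .
qed

text \<open>The absolute moment of the log-likelihood ratio under state \<open>k\<close>. The bounds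
  for the two messages, with \<open>h\<close> and \<open>1 - h\<close> as integrands' weights, add
  up to it.\<close>

definition kl_bound :: "nat \<Rightarrow> nat \<Rightarrow> real" where
  "kl_bound k l = (\<integral>x. \<bar>f k x * ln (f k x / f l x)\<bar> \<partial>N)"

text \<open>All divergences from state \<open>k\<close> are collected in one sequence, with value 0
  at \<open>k\<close> and beyond \<open>M\<close>, so that mixtures and compactness apply to whole
  divergence vectors.\<close>

definition divergence :: "nat \<Rightarrow> (nat \<Rightarrow> real) \<Rightarrow> nat \<Rightarrow> real" where
  "divergence k v l = (if l < M \<and> l \<noteq> k then klterm (v k) (v l) + klterm (1 - v k) (1 - v l) else 0)"

lemma divergence_pv_le:
  assumes "h \<in> fuzzy" "k < M" "l < M" "l \<noteq> k"
  shows "divergence k (pv h) l \<le> kl_bound k l"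
proof -
  let ?g = "\<lambda>x. \<bar>f k x * ln (f k x / f l x)\<bar>"
  have kl: "k \<noteq> l" using assms by auto
  have int: "integrable N (\<lambda>x. h x * ?g x)" "integrable N (\<lambda>x. (1 - h x) * ?g x)"
    using fuzzy_mult_integrable[OF _ integrable_abs[OF kl_integrable[OF assms(2,3) kl]]]
      assms(1) fuzzy_compl[OF assms(1)] by auto
  have "divergence k (pv h) l \<le> (\<integral>x. h x * ?g x \<partial>N) + (\<integral>x. (1 - h x) * ?g x \<partial>N)"
    using klterm_pv_le[OF assms(1-3) kl] klterm_pv_le[OF fuzzy_compl[OF assms(1)] assms(2,3) kl] assms
    by (simp add: divergence_def pv_compl)
  also have "\<dots> = (\<integral>x. h x * ?g x + (1 - h x) * ?g x \<partial>N)"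
    using int by simp
  also have "\<dots> = kl_bound k l" unfolding kl_bound_def by (simp add: algebra_simps)
  finally show ?thesis .
qed

text \<open>The tangent bounds with \<open>c = 1\<close> for the two messages cancel each
  other.\<close>

lemma divergence_pv_nonneg:
  assumes "h \<in> fuzzy" "k < M"
  shows "0 \<le> divergence k (pv h) l"
proof (cases "l < M \<and> l \<noteq> k")
  case True
  have "pv h k - pv h l \<le> klterm (pv h k) (pv h l)"
    using klterm_ge_tangent[of "pv h k" "pv h l" 1] pv_nonneg[OF assms(1)] pv_eq_0[OF assms(1), of l k] assms True
    by auto
  moreover have "pv (\<lambda>x. 1 - h x) k - pv (\<lambda>x. 1 - h x) l \<le> klterm (pv (\<lambda>x. 1 - h x) k) (pv (\<lambda>x. 1 - h x) l)"
    using klterm_ge_tangent[of "pv (\<lambda>x. 1 - h x) k" "pv (\<lambda>x. 1 - h x) l" 1]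
      pv_nonneg[OF fuzzy_compl[OF assms(1)]] pv_eq_0[OF fuzzy_compl[OF assms(1)], of l k] assms True
    by auto
  ultimately show ?thesis using True assms by (simp add: divergence_def pv_compl)
qed (auto simp: divergence_def)

text \<open>One log-sum inequality per message. It ensures that writing an achievable vector as a
  mixture of others cannot lower the averaged divergence.\<close>

lemma divergence_convex:
  assumes "finite S" "\<And>i. i \<in> S \<Longrightarrow> 0 \<le> w i" "sum w S = 1" "\<And>i. i \<in> S \<Longrightarrow> e i \<in> pv ` fuzzy" "k < M"
  shows "divergence k (\<lambda>j. \<Sum>i\<in>S. w i * e i j) l \<le> (\<Sum>i\<in>S. w i * divergence k (e i) l)"
proof (cases "l < M \<and> l \<noteq> k")
  case True
  from assms(4) have "\<forall>i\<in>S. \<exists>h\<in>fuzzy. e i = pv h" by blast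
  then obtain h where h: "\<And>i. i \<in> S \<Longrightarrow> h i \<in> fuzzy" "\<And>i. i \<in> S \<Longrightarrow> e i = pv (h i)" by metis
  have "klterm (\<Sum>i\<in>S. w i * e i k) (\<Sum>i\<in>S. w i * e i l) \<le> (\<Sum>i\<in>S. w i * klterm (e i k) (e i l))"
  proof (rule klterm_sum_le)
    fix i assume i: "i \<in> S"
    then show "0 \<le> e i k" "0 \<le> e i l" using h pv_nonneg by auto
    show "e i k = 0" if "e i l = 0"
      using pv_eq_0[OF h(1)[OF i], of l k] h(2)[OF i] that True assms(5) by simp
  qed (use assms in auto)
  moreover have "klterm (\<Sum>i\<in>S. w i * (1 - e i k)) (\<Sum>i\<in>S. w i * (1 - e i l))
      \<le> (\<Sum>i\<in>S. w i * klterm (1 - e i k) (1 - e i l))"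
  proof (rule klterm_sum_le)
    fix i assume "i \<in> S"
    then show "0 \<le> 1 - e i k" "0 \<le> 1 - e i l" using h pv_le_1 by auto
    assume "1 - e i l = 0"
    then show "1 - e i k = 0"
      using pv_eq_0[OF fuzzy_compl[OF h(1)[OF \<open>i \<in> S\<close>]], of l k] h \<open>i \<in> S\<close> True assms(5) by (simp add: pv_compl)
  qed (use assms in auto)
  moreover have "(\<Sum>i\<in>S. w i * (1 - e i j)) = 1 - (\<Sum>i\<in>S. w i * e i j)" for j
    using assms(3) by (simp add: right_diff_distrib sum_subtractf)
  ultimately show ?thesis using True
    by (simp add: divergence_def distrib_left sum.distrib)
qed (auto simp: divergence_def)

text \<open>Truncate \<open>g\<close> at a large multiple of \<open>f k\<close>. The truncated part
  is controlled by \<open>pv (h n) k\<close>, and the remainder is small uniformly in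
  \<open>n\<close> because \<open>0 \<le> h n \<le> 1\<close>.\<close>

lemma fuzzy_integral_tendsto_0:
  assumes h: "\<And>n. h n \<in> fuzzy" and k: "k < M" and g: "integrable N g" "\<And>x. 0 \<le> g x"
    and supp: "AE x in N. f k x = 0 \<longrightarrow> g x = 0" and lim: "(\<lambda>n. pv (h n) k) \<longlonglongrightarrow> 0"
  shows "(\<lambda>n. \<integral>x. h n x * g x \<partial>N) \<longlonglongrightarrow> 0"
proof (rule LIMSEQ_I)
  fix e :: real assume e: "0 < e"
  \<comment> \<open>The excess of \<open>g\<close> over the truncation level; it is eventually zero
    wherever \<open>f k\<close> is positive, and \<open>supp\<close> handles the other
    points.\<close>
  define r where "r K x = g x - min (g x) (real K * f k x)" for K x
  have "(\<lambda>K. \<integral>x. r K x \<partial>N) \<longlonglongrightarrow> (\<integral>x. 0 \<partial>N)"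
  proof (rule integral_dominated_convergence[where w = g])
    show "AE x in N. (\<lambda>K. r K x) \<longlonglongrightarrow> 0"
      using supp AE_f_nonneg[OF k]
    proof eventually_elim
      case (elim x)
      show ?case
      proof (cases "f k x = 0")
        case True
        with elim show ?thesis by (simp add: r_def)
      next
        case False
        with elim have pos: "0 < f k x" by auto
        then obtain K0 where K0: "g x < real K0 * f k x" using reals_Archimedean3 by blast
        have "r K x = 0" if "K0 \<le> K" for K
        proof -
          have "real K0 * f k x \<le> real K * f k x" using pos that by (intro mult_right_mono) auto
          with K0 show ?thesis by (simp add: r_def)
        qed
        then show ?thesis by (intro tendsto_eventually eventually_sequentiallyI[of K0])
      qed
    qed
    show "AE x in N. norm (r K x) \<le> g x" for K
      using AE_f_nonneg[OF k] by eventually_elim (auto simp: r_def min_def g(2))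
  qed (use g k in \<open>auto simp: r_def\<close>)
  then have "(\<lambda>K. \<integral>x. r K x \<partial>N) \<longlonglongrightarrow> 0" by simp
  from LIMSEQ_D[OF this, of "e / 2"] e obtain K where "norm ((\<integral>x. r K x \<partial>N) - 0) < e / 2" by auto
  then have K: "(\<integral>x. r K x \<partial>N) < e / 2" by simp
  have rint: "integrable N (r K)"
    unfolding r_def using g f_integrable[OF k] by (intro Bochner_Integration.integrable_diff integrable_min integrable_mult_right)
  \<comment> \<open>The summand 1 in the denominator also admits \<open>K = 0\<close>.\<close>
  from LIMSEQ_D[OF lim, of "e / (2 * (real K + 1))"] e obtain n0
    where n0: "\<And>n. n \<ge> n0 \<Longrightarrow> norm (pv (h n) k) < e / (2 * (real K + 1))" by auto
  show "\<exists>n0. \<forall>n\<ge>n0. norm ((\<integral>x. h n x * g x \<partial>N) - 0) < e"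
  proof (intro exI allI impI)
    fix n assume n: "n0 \<le> n"
    have "(\<integral>x. h n x * g x \<partial>N) \<le> (\<integral>x. real K * (h n x * f k x) + r K x \<partial>N)"
    proof (rule integral_mono_AE)
      show "integrable N (\<lambda>x. h n x * g x)" using h g by (intro fuzzy_mult_integrable)
      show "integrable N (\<lambda>x. real K * (h n x * f k x) + r K x)"
        using pv_integrable[OF h k] rint by auto
      show "AE x in N. h n x * g x \<le> real K * (h n x * f k x) + r K x"
      proof (rule AE_I2)
        fix x assume x: "x \<in> space N"
        have b: "0 \<le> h n x" "h n x \<le> 1" "0 \<le> f k x" using fuzzy_bounds[OF h x] f_nonneg[OF k x] by auto
        have r0: "0 \<le> r K x" by (simp add: r_def)
        have "h n x * g x = h n x * min (g x) (real K * f k x) + h n x * r K x"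
          by (simp add: r_def algebra_simps)
        also have "\<dots> \<le> h n x * (real K * f k x) + 1 * r K x"
          using b r0 by (intro add_mono mult_left_mono mult_right_mono) auto
        finally show "h n x * g x \<le> real K * (h n x * f k x) + r K x" by (simp add: algebra_simps)
      qed
    qed
    also have "\<dots> = real K * pv (h n) k + (\<integral>x. r K x \<partial>N)"
      using pv_integrable[OF h k] rint k by (simp add: pv_def)
    also have "\<dots> < e"
    proof -
      have "real K * pv (h n) k \<le> (real K + 1) * (e / (2 * (real K + 1)))"
        using n0[OF n] pv_nonneg[OF h, of n k] by (intro mult_mono) auto
      also have "\<dots> = e / 2" by (simp add: field_simps)
      finally show ?thesis using K by simp
    qed
    finally have "(\<integral>x. h n x * g x \<partial>N) < e" .
    moreover have "0 \<le> (\<integral>x. h n x * g x \<partial>N)"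
      using h g by (intro integral_nonneg_AE AE_I2) (auto simp: fuzzy_bounds)
    ultimately show "norm ((\<integral>x. h n x * g x \<partial>N) - 0) < e" by simp
  qed
qed

text \<open>If the limit is nondegenerate, the formula is continuous there. Otherwise both
  coordinates tend to zero with an uncontrolled ratio, and \<open>klterm\<close> is squeezed between
  the tangent bound with \<open>c = 1\<close> and the integral bound.\<close>

lemma klterm_pv_tendsto:
  assumes hn: "\<And>n. h n \<in> fuzzy" and h0: "h0 \<in> fuzzy" and kl: "k < M" "l < M" "k \<noteq> l"
    and lim: "\<And>j. j < M \<Longrightarrow> (\<lambda>n. pv (h n) j) \<longlonglongrightarrow> pv h0 j"
  shows "(\<lambda>n. klterm (pv (h n) k) (pv (h n) l)) \<longlonglongrightarrow> klterm (pv h0 k) (pv h0 l)"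
proof (cases "pv h0 k = 0")
  case True
  then have l0: "pv h0 l = 0" using pv_eq_0[OF h0 kl(1,2)] by simp
  define g where "g x = \<bar>f k x * ln (f k x / f l x)\<bar>" for x
  have ub: "(\<lambda>n. \<integral>x. h n x * g x \<partial>N) \<longlonglongrightarrow> 0"
    using lim[OF kl(1)] True
    by (intro fuzzy_integral_tendsto_0[OF hn kl(1)])
      (auto simp: g_def intro!: integrable_abs kl_integrable kl)
  have lb: "(\<lambda>n. pv (h n) k - pv (h n) l) \<longlonglongrightarrow> 0"
    using tendsto_diff[OF lim[OF kl(1)] lim[OF kl(2)]] True l0 by simp
  have le1: "pv (h n) k - pv (h n) l \<le> klterm (pv (h n) k) (pv (h n) l)" for n
    using klterm_ge_tangent[of "pv (h n) k" "pv (h n) l" 1] pv_nonneg[OF hn] pv_eq_0[OF hn, of l k] kl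
    by auto
  have le2: "klterm (pv (h n) k) (pv (h n) l) \<le> (\<integral>x. h n x * g x \<partial>N)" for n
    unfolding g_def by (rule klterm_pv_le[OF hn kl])
  have "(\<lambda>n. klterm (pv (h n) k) (pv (h n) l)) \<longlonglongrightarrow> 0"
    by (rule tendsto_sandwich[OF _ _ lb ub]) (simp_all add: le1 le2)
  with True show ?thesis by (simp add: klterm_def)
next
  case False
  then have l0: "pv h0 l \<noteq> 0" using pv_eq_0[OF h0 kl(2,1)] by blast
  have "(\<lambda>n. pv (h n) k * ln (pv (h n) k / pv (h n) l)) \<longlonglongrightarrow> pv h0 k * ln (pv h0 k / pv h0 l)"
    using False l0 kl by (intro tendsto_intros lim) auto
  moreover have "klterm p q = p * ln (p / q)" for p q by (simp add: klterm_def)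
  ultimately show ?thesis by simp
qed

text \<open>The restriction to achievable vectors matters, since \<open>klterm\<close> is
  discontinuous at \<open>(0, 0)\<close>. The second message is the first message of the
  complementary test.\<close>

lemma continuous_on_divergence:
  assumes "k < M"
  shows "continuous_on (pv ` fuzzy) (divergence k)"
proof (rule continuous_on_coordinatewise_then_product)
  fix l
  show "continuous_on (pv ` fuzzy) (\<lambda>v. divergence k v l)"
  proof (cases "l < M \<and> l \<noteq> k")
    case True
    show ?thesis
    proof (rule continuous_on_sequentiallyI)
      fix u a assume u: "\<forall>n. u n \<in> pv ` fuzzy" "a \<in> pv ` fuzzy" "u \<longlonglongrightarrow> a"
      then have "\<forall>n. \<exists>h\<in>fuzzy. u n = pv h" by blast
      then obtain h where h: "\<And>n. h n \<in> fuzzy" "\<And>n. u n = pv (h n)" by metis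
      from u obtain h0 where h0: "h0 \<in> fuzzy" "a = pv h0" by blast
      have "(\<lambda>n. u n j) \<longlonglongrightarrow> a j" for j
        by (rule tendsto_fun_coordinate[OF u(3)])
      then have lim: "(\<lambda>n. pv (h n) j) \<longlonglongrightarrow> pv h0 j" for j
        using h h0 by simp
      have lim': "(\<lambda>n. pv (\<lambda>x. 1 - h n x) j) \<longlonglongrightarrow> pv (\<lambda>x. 1 - h0 x) j" if "j < M" for j
        using that h h0 by (auto simp: pv_compl intro!: tendsto_intros lim)
      show "(\<lambda>n. divergence k (u n) l) \<longlonglongrightarrow> divergence k a l"
        using tendsto_add[OF klterm_pv_tendsto[of h h0 k l] klterm_pv_tendsto[of "\<lambda>n x. 1 - h n x" "\<lambda>x. 1 - h0 x" k l]]
          True assms h h0 lim lim' fuzzy_compl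
        by (simp add: divergence_def pv_compl)
    qed
  next
    case False
    then have "(\<lambda>v. divergence k v l) = (\<lambda>_. 0)" by (auto simp: divergence_def)
    then show ?thesis by (metis continuous_on_const)
  qed
qed

section \<open>Compactness of the set of achievable vectors\<close>

lemma fuzzy_midpoint:
  assumes "g \<in> fuzzy" "h \<in> fuzzy"
  shows "(\<lambda>x. (g x + h x) / 2) \<in> fuzzy" "k < M \<Longrightarrow> pv (\<lambda>x. (g x + h x) / 2) k = (pv g k + pv h k) / 2"
proof -
  have "g x + h x \<le> 2" if "x \<in> space N" for x
    using fuzzy_bounds(2)[OF assms(1) that] fuzzy_bounds(2)[OF assms(2) that] by linarith
  then show "(\<lambda>x. (g x + h x) / 2) \<in> fuzzy" using assms by (auto simp: fuzzy_def)
  assume k: "k < M"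
  have "(\<integral>x. (g x + h x) / 2 * f k x \<partial>N) = (\<integral>x. (g x * f k x + h x * f k x) / 2 \<partial>N)"
    by (simp add: algebra_simps)
  also have "\<dots> = (pv g k + pv h k) / 2"
    using pv_integrable[OF assms(1) k] pv_integrable[OF assms(2) k] k by (simp add: pv_def)
  finally show "pv (\<lambda>x. (g x + h x) / 2) k = (pv g k + pv h k) / 2" using k by (simp add: pv_def)
qed

text \<open>An elementary substitute for weak compactness of the set of tests: strong convergence is
  forced by near-minimal norms, and the limit test has the limit vector by dominated
  convergence.\<close>

lemma closed_pv_fuzzy: "closed (pv ` fuzzy)"
  unfolding closed_sequential_limits
proof (intro allI impI, elim conjE)
  fix u v assume u: "\<forall>n. u n \<in> pv ` fuzzy" and uv: "u \<longlonglongrightarrow> v"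
  \<comment> \<open>The measure with density \<open>F\<close> is finite and dominates all states, so
    convergence almost everywhere with respect to it serves all coordinates at once.\<close>
  define F where "F x = (\<Sum>k<M. f k x)" for x
  have F_int: "integrable N F" unfolding F_def using f_integrable by (intro Bochner_Integration.integrable_sum) auto
  have F_nn: "0 \<le> F x" if "x \<in> space N" for x unfolding F_def using f_nonneg that by (intro sum_nonneg) auto
  have F_le: "f k x \<le> F x" if "k < M" "x \<in> space N" for k x
    unfolding F_def using f_nonneg that by (intro member_le_sum) auto
  define B where "B = (\<integral>x. F x \<partial>N)"
  have B0: "0 \<le> B" unfolding B_def using F_nn by (intro integral_nonneg_AE) auto
  \<comment> \<open>Elements of almost minimal norm in the decreasing convex sets \<open>C n\<close> form a Cauchy sequence,
    by the parallelogram identity.\<close>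
  define C where "C n = {g \<in> fuzzy. \<forall>k<M. \<bar>pv g k - v k\<bar> \<le> 1 / (real n + 1)}" for n
  define E where "E g = (\<integral>x. (g x)\<^sup>2 * F x \<partial>N)" for g
  have sq: "(\<lambda>x. (g x)\<^sup>2) \<in> fuzzy" if "g \<in> fuzzy" for g
    using that by (auto simp: fuzzy_def power_le_one)
  have E_int: "integrable N (\<lambda>x. (g x)\<^sup>2 * F x)" if "g \<in> fuzzy" for g
    using fuzzy_mult_integrable[OF sq[OF that] F_int] .
  have E_nn: "0 \<le> E g" if "g \<in> fuzzy" for g
    unfolding E_def using F_nn by (intro integral_nonneg_AE) auto
  have E_le: "E g \<le> B" if "g \<in> fuzzy" for g
    unfolding E_def B_def using that F_nn
    by (intro integral_mono_AE E_int F_int AE_I2) (auto simp: mult_left_le_one_le power_le_one fuzzy_bounds)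
  have C_ne: "C n \<noteq> {}" for n
  proof -
    have "\<forall>\<^sub>F i in sequentially. \<bar>u i k - v k\<bar> \<le> 1 / (real n + 1)" for k
    proof -
      have "\<forall>\<^sub>F i in sequentially. dist (u i k) (v k) < 1 / (real n + 1)"
        using tendsto_fun_coordinate[OF uv] by (rule tendstoD) simp
      then show ?thesis by eventually_elim (simp add: dist_real_def)
    qed
    then have "\<forall>\<^sub>F i in sequentially. \<forall>k\<in>{..<M}. \<bar>u i k - v k\<bar> \<le> 1 / (real n + 1)"
      by (intro eventually_ball_finite) auto
    then obtain i where "\<forall>k\<in>{..<M}. \<bar>u i k - v k\<bar> \<le> 1 / (real n + 1)"
      using eventually_happens'[OF sequentially_bot] by blast
    moreover from u obtain g where "g \<in> fuzzy" "u i = pv g" by blast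
    ultimately show ?thesis by (auto simp: C_def)
  qed
  have C_fuzzy: "g \<in> fuzzy" if "g \<in> C n" for g n using that by (simp add: C_def)
  have C_mono: "C n \<subseteq> C i" if "i \<le> n" for i n
  proof -
    have "1 / (real n + 1) \<le> 1 / (real i + 1)" using that by (intro divide_left_mono) auto
    then show ?thesis by (fastforce simp: C_def)
  qed
  define d where "d n = Inf (E ` C n)" for n
  have bdd: "bdd_below (E ` C n)" for n using E_nn C_fuzzy by (intro bdd_belowI[of _ 0]) blast
  have d_le: "d n \<le> E g" if "g \<in> C n" for g n
    unfolding d_def using that bdd by (intro cInf_lower) auto
  have d_mono: "incseq d"
    unfolding incseq_def d_def using C_mono C_ne bdd by (intro allI impI cInf_superset_mono) auto
  have d_B: "d n \<le> B" for n
    using C_ne[of n] d_le[of _ n] E_le C_fuzzy by (metis all_not_in_conv order_trans)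
  \<comment> \<open>Shrinking the sets raises the infima, which stay below \<open>B\<close>.\<close>
  obtain L where L: "d \<longlonglongrightarrow> L" "\<And>n. d n \<le> L" using incseq_convergent[OF d_mono] d_B by metis
  have "\<exists>g\<in>C n. E g < d n + 1 / (real n + 1)" for n
    using cInf_lessD[of "E ` C n" "d n + 1 / (real n + 1)"] C_ne[of n] by (auto simp: d_def)
  then obtain g where g: "\<And>n. g n \<in> C n" "\<And>n. E (g n) < d n + 1 / (real n + 1)" by metis
  have gf: "g n \<in> fuzzy" for n using g C_fuzzy by blast
  have D_int: "integrable N (\<lambda>x. (g i x - g j x)\<^sup>2 * F x)" for i j
  proof -
    have "(\<lambda>x. \<bar>g i x - g j x\<bar>) \<in> fuzzy"
      using gf[of i] gf[of j] unfolding fuzzy_def by (auto simp: abs_le_iff intro: order_trans[OF diff_mono])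
    from E_int[OF this] show ?thesis by simp
  qed
  have L2: "(\<integral>x. (g i x - g j x)\<^sup>2 * F x \<partial>N) \<le> 4 * (L - d n + 1 / (real n + 1))" if "n \<le> i" "n \<le> j" for i j n
  proof -
    \<comment> \<open>The midpoint stays in the convex set \<open>C n\<close>, so its norm is
      bounded below by \<open>d n\<close>, whereas \<open>g i\<close> and \<open>g j\<close> are
      bounded above in terms of \<open>L\<close>.\<close>
    let ?m = "\<lambda>x. (g i x + g j x) / 2"
    have "g i \<in> C n" "g j \<in> C n" using g C_mono that by blast+
    then have b: "\<bar>pv (g i) k - v k\<bar> \<le> 1 / (real n + 1)" "\<bar>pv (g j) k - v k\<bar> \<le> 1 / (real n + 1)" if "k < M" for k
      using that by (auto simp: C_def)
    have mid: "\<bar>(a + b) / 2 - c\<bar> \<le> e" if "\<bar>a - c\<bar> \<le> e" "\<bar>b - c\<bar> \<le> e" for a b c e :: real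
      using that by (auto simp: abs_le_iff field_simps)
    have "\<bar>pv ?m k - v k\<bar> \<le> 1 / (real n + 1)" if "k < M" for k
      unfolding fuzzy_midpoint(2)[OF gf[of i] gf[of j] that] by (rule mid[OF b[OF that]])
    then have "?m \<in> C n"
      unfolding C_def using fuzzy_midpoint(1)[OF gf[of i] gf[of j]] by simp
    then have m: "d n \<le> E ?m" "?m \<in> fuzzy" using d_le C_fuzzy by auto
    have "(\<integral>x. (g i x - g j x)\<^sup>2 * F x \<partial>N)
        = (\<integral>x. 2 * ((g i x)\<^sup>2 * F x) + 2 * ((g j x)\<^sup>2 * F x) - 4 * ((?m x)\<^sup>2 * F x) \<partial>N)"
      by (intro Bochner_Integration.integral_cong) (auto simp: power2_eq_square field_simps)
    also have "\<dots> = 2 * E (g i) + 2 * E (g j) - 4 * E ?m"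
      unfolding E_def using E_int[OF gf] E_int[OF m(2)] by simp
    also have "\<dots> \<le> 2 * (L + 1 / (real n + 1)) + 2 * (L + 1 / (real n + 1)) - 4 * d n"
    proof -
      have "E (g l) \<le> L + 1 / (real n + 1)" if "n \<le> l" for l
      proof -
        have "1 / (real l + 1) \<le> 1 / (real n + 1)" using that by (intro divide_left_mono) auto
        with g(2)[of l] L(2)[of l] show ?thesis by linarith
      qed
      from this[OF that(1)] this[OF that(2)] m(1) show ?thesis
        by (intro diff_mono add_mono mult_left_mono) auto
    qed
    finally show ?thesis by (simp add: algebra_simps)
  qed
  have L2_lim: "(\<lambda>n. 4 * (L - d n + 1 / (real n + 1))) \<longlonglongrightarrow> 0"
  proof -
    have "(\<lambda>n. 1 / (real n + 1)) \<longlonglongrightarrow> 0"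
      using LIMSEQ_inverse_real_of_nat by (simp add: inverse_eq_divide add.commute)
    then have "(\<lambda>n. 4 * (L - d n + 1 / (real n + 1))) \<longlonglongrightarrow> 4 * (L - L + 0)"
      by (intro tendsto_intros L(1))
    then show ?thesis by simp
  qed
  have Fm: "F \<in> borel_measurable N" using F_int by auto
  have g_meas [measurable]: "g n \<in> borel_measurable N" for n using fuzzy_measurable[OF gf] .
  have F_AE: "AE x in N. 0 \<le> F x" using F_nn by auto
  obtain r where r: "strict_mono r" "AE x in density N F. Cauchy (\<lambda>i. g (r i) x)"
  proof (rule cauchy_L1_AE_cauchy_subseq[of "density N F" g])
    show "integrable (density N F) (g n)" for n
      using Fm F_AE fuzzy_mult_integrable[OF gf F_int, of n] by (subst integrable_density) (auto simp: mult.commute)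
  next
    fix e :: real assume e: "0 < e"
    \<comment> \<open>The parameter of \<open>a \<le> \<delta> / 2 + a * a / (2 * \<delta>)\<close>,
      which passes from L2 to L1. It is chosen with \<open>\<delta> * B < e\<close>; the summand 1
      covers \<open>B = 0\<close>.\<close>
    define \<delta> where "\<delta> = e / (B + 1)"
    have \<delta>: "0 < \<delta>" using e B0 by (simp add: \<delta>_def)
    from LIMSEQ_D[OF L2_lim, of "\<delta> * e"] e \<delta> obtain n0
      where n0: "\<bar>4 * (L - d n0 + 1 / (real n0 + 1))\<bar> < \<delta> * e" by auto
    have "(LINT x|density N F. norm (g i x - g j x)) < e" if "n0 \<le> i" "n0 \<le> j" for i j
    proof -
      have "(LINT x|density N F. norm (g i x - g j x)) = (\<integral>x. F x * \<bar>g i x - g j x\<bar> \<partial>N)"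
        using Fm F_AE by (subst integral_density) auto
      also have "\<dots> \<le> (\<integral>x. \<delta> / 2 * F x + 1 / (2 * \<delta>) * ((g i x - g j x)\<^sup>2 * F x) \<partial>N)"
      proof (rule integral_mono_AE)
        show "integrable N (\<lambda>x. \<delta> / 2 * F x + 1 / (2 * \<delta>) * ((g i x - g j x)\<^sup>2 * F x))"
          using F_int D_int by auto
        show "integrable N (\<lambda>x. F x * \<bar>g i x - g j x\<bar>)"
        proof (rule Bochner_Integration.integrable_bound[OF F_int])
          show "AE x in N. norm (F x * \<bar>g i x - g j x\<bar>) \<le> norm (F x)"
          proof (rule AE_I2)
            fix x assume x: "x \<in> space N"
            have "\<bar>g i x - g j x\<bar> \<le> 1" using fuzzy_bounds[OF gf x, of i] fuzzy_bounds[OF gf x, of j] by linarith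
            with F_nn[OF x] show "norm (F x * \<bar>g i x - g j x\<bar>) \<le> norm (F x)"
              by (simp add: abs_mult mult_left_le)
          qed
        qed (use Fm in auto)
        show "AE x in N. F x * \<bar>g i x - g j x\<bar> \<le> \<delta> / 2 * F x + 1 / (2 * \<delta>) * ((g i x - g j x)\<^sup>2 * F x)"
        proof (rule AE_I2)
          fix x assume x: "x \<in> space N"
          define a where "a = \<bar>g i x - g j x\<bar>"
          have "0 \<le> (a - \<delta>)\<^sup>2 / (2 * \<delta>)" using \<delta> by simp
          then have "a \<le> \<delta> / 2 + 1 / (2 * \<delta>) * a\<^sup>2" using \<delta> by (simp add: power2_eq_square field_simps)
          then have "F x * a \<le> F x * (\<delta> / 2 + 1 / (2 * \<delta>) * a\<^sup>2)" using F_nn[OF x] by (rule mult_left_mono)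
          then show "F x * \<bar>g i x - g j x\<bar> \<le> \<delta> / 2 * F x + 1 / (2 * \<delta>) * ((g i x - g j x)\<^sup>2 * F x)"
            by (simp add: a_def algebra_simps)
        qed
      qed
      also have "\<dots> = \<delta> / 2 * B + 1 / (2 * \<delta>) * (\<integral>x. (g i x - g j x)\<^sup>2 * F x \<partial>N)"
        using F_int D_int unfolding B_def by simp
      also have "\<dots> \<le> \<delta> / 2 * B + 1 / (2 * \<delta>) * (\<delta> * e)"
        using L2[OF that] n0 \<delta> by (intro add_mono mult_left_mono) auto
      also have "\<dots> = (\<delta> * B + e) / 2" using \<delta> by (simp add: field_simps)
      also have "\<dots> < e"
      proof -
        have "\<delta> * B < e" using e B0 by (simp add: \<delta>_def field_simps)
        then show ?thesis by simp
      qed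
      finally show ?thesis .
    qed
    then show "\<exists>n0. \<forall>i\<ge>n0. \<forall>j\<ge>n0. (LINT x|density N F. norm (g i x - g j x)) < e" by blast
  qed
  \<comment> \<open>Clipping keeps \<open>h\<close> a test also at points where the subsequence
    diverges; at points of convergence it changes nothing.\<close>
  define h where "h x = max 0 (min 1 (lim (\<lambda>n. g (r n) x)))" for x
  have hf: "h \<in> fuzzy"
    unfolding fuzzy_def h_def by auto
  have conv: "AE x in N. 0 < F x \<longrightarrow> (\<lambda>n. g (r n) x) \<longlonglongrightarrow> h x"
  proof -
    have "AE x in N. 0 < F x \<longrightarrow> Cauchy (\<lambda>i. g (r i) x)"
      using r(2) Fm by (subst (asm) AE_density) auto
    then show ?thesis using AE_space
    proof eventually_elim
      case (elim x)
      show ?case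
      proof
        assume "0 < F x"
        with elim have "convergent (\<lambda>i. g (r i) x)" by (simp add: Cauchy_convergent_iff)
        then have l: "(\<lambda>i. g (r i) x) \<longlonglongrightarrow> lim (\<lambda>n. g (r n) x)" by (simp add: convergent_LIMSEQ_iff)
        have "0 \<le> lim (\<lambda>n. g (r n) x)"
          using elim fuzzy_bounds[OF gf] by (intro LIMSEQ_le_const[OF l]) auto
        moreover have "lim (\<lambda>n. g (r n) x) \<le> 1"
          using elim fuzzy_bounds[OF gf] by (intro LIMSEQ_le_const2[OF l]) auto
        ultimately show "(\<lambda>n. g (r n) x) \<longlonglongrightarrow> h x" using l by (simp add: h_def)
      qed
    qed
  qed
  have "pv h k = v k" for k
  proof (cases "k < M")
    case True
    have "(\<lambda>n. \<integral>x. g (r n) x * f k x \<partial>N) \<longlonglongrightarrow> (\<integral>x. h x * f k x \<partial>N)"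
    proof (rule integral_dominated_convergence[where w = "f k"])
      show "AE x in N. (\<lambda>n. g (r n) x * f k x) \<longlonglongrightarrow> h x * f k x"
        using conv AE_space
      proof eventually_elim
        case (elim x)
        show ?case
        proof (cases "f k x = 0")
          case False
          then have "0 < F x" using F_le[OF True elim(2)] f_nonneg[OF True elim(2)] by linarith
          with elim show ?thesis by (auto intro!: tendsto_intros)
        qed simp
      qed
      show "AE x in N. norm (g (r n) x * f k x) \<le> f k x" for n
        using fuzzy_bounds[OF gf] f_nonneg[OF True] by (intro AE_I2) (auto simp: abs_mult mult_left_le_one_le)
    qed (use True f_integrable fuzzy_measurable[OF hf] in auto)
    then have "(\<lambda>n. pv (g (r n)) k) \<longlonglongrightarrow> pv h k" using True by (simp add: pv_def)
    moreover have "(\<lambda>n. pv (g (r n)) k) \<longlonglongrightarrow> v k"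
    proof (rule LIM_zero_cancel, rule tendsto_rabs_zero_cancel, rule tendsto_sandwich[OF _ _ tendsto_const])
      show "(\<lambda>n. 1 / (real n + 1)) \<longlonglongrightarrow> 0"
        using LIMSEQ_inverse_real_of_nat by (simp add: inverse_eq_divide add.commute)
      \<comment> \<open>Since \<open>n \<le> r n\<close>, the function \<open>g (r n)\<close>
        belongs to \<open>C n\<close>.\<close>
      have "\<bar>pv (g (r n)) k - v k\<bar> \<le> 1 / (real n + 1)" for n
        using C_mono[OF seq_suble[OF r(1)], of n] g(1)[of "r n"] True by (auto simp: C_def)
      then show "\<forall>\<^sub>F n in sequentially. \<bar>pv (g (r n)) k - v k\<bar> \<le> 1 / (real n + 1)" by simp
    qed simp
    ultimately show ?thesis by (rule LIMSEQ_unique)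
  next
    case False
    then have "u n k = 0" for n using u by (auto simp: pv_def image_iff dest!: spec[of _ n])
    with tendsto_fun_coordinate[OF uv, of k] have "(\<lambda>n. 0) \<longlonglongrightarrow> v k" by simp
    then have "v k = 0" by (simp add: LIMSEQ_const_iff)
    with False show ?thesis by (simp add: pv_def)
  qed
  then have "v = pv h" by auto
  with hf show "v \<in> pv ` fuzzy" by blast
qed

lemma compact_pv_fuzzy: "compact (pv ` fuzzy)"
proof -
  have "compact ({v :: nat \<Rightarrow> real. \<forall>k. v k \<in> {0..1}} \<inter> pv ` fuzzy)"
    by (intro compact_Int_closed compact_Pi_UNIV closed_pv_fuzzy) auto
  also have "{v :: nat \<Rightarrow> real. \<forall>k. v k \<in> {0..1}} \<inter> pv ` fuzzy = pv ` fuzzy"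
    using pv_nonneg pv_le_1 by auto
  finally show ?thesis .
qed

section \<open>Mixtures of deterministic quantizers\<close>

lemma fuzzy_of_bool: "det_quantizer N \<phi> \<Longrightarrow> (\<lambda>x. of_bool (\<phi> x)) \<in> fuzzy"
  unfolding det_quantizer_def fuzzy_def by auto

lemma pv_add_scaled:
  assumes "g \<in> fuzzy" "h \<in> fuzzy"
  shows "pv (\<lambda>x. h x + c * g x) k = pv h k + c * pv g k"
proof (cases "k < M")
  case True
  have "(\<integral>x. (h x + c * g x) * f k x \<partial>N) = (\<integral>x. h x * f k x + c * (g x * f k x) \<partial>N)"
    by (simp add: algebra_simps)
  also have "\<dots> = (\<integral>x. h x * f k x \<partial>N) + c * (\<integral>x. g x * f k x \<partial>N)"
    using pv_integrable[OF assms(1) True] pv_integrable[OF assms(2) True] by simp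
  finally show ?thesis using True by (simp add: pv_def)
qed (simp add: pv_def)

text \<open>The largest pointwise perturbation that can be both added to and subtracted from a test;
  it vanishes exactly where the test is 0 or 1, and so measures the failure to be
  deterministic.\<close>

definition indecision :: "('a \<Rightarrow> real) \<Rightarrow> 'a \<Rightarrow> real" where
  "indecision h x = min (h x) (1 - h x)"

lemma indecision_fuzzy:
  assumes "h \<in> fuzzy"
  shows "indecision h \<in> fuzzy" "(\<lambda>x. h x + indecision h x) \<in> fuzzy" "(\<lambda>x. h x - indecision h x) \<in> fuzzy"
proof -
  have [measurable]: "h \<in> borel_measurable N" by (rule fuzzy_measurable[OF assms])
  have "0 \<le> indecision h x \<and> indecision h x \<le> 1 \<and> 0 \<le> h x + indecision h x \<and> h x + indecision h x \<le> 1
      \<and> 0 \<le> h x - indecision h x \<and> h x - indecision h x \<le> 1" if "x \<in> space N" for x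
    using fuzzy_bounds[OF assms that] by (auto simp: indecision_def min_def)
  moreover have "indecision h \<in> borel_measurable N" unfolding indecision_def by measurable
  ultimately show "indecision h \<in> fuzzy" "(\<lambda>x. h x + indecision h x) \<in> fuzzy" "(\<lambda>x. h x - indecision h x) \<in> fuzzy"
    by (auto simp: fuzzy_def)
qed

text \<open>Such a test is 0 or 1 almost surely in every state, and thresholding at 1/2 then leaves
  its vector unchanged.\<close>

lemma pv_indecision_eq_0:
  assumes h: "h \<in> fuzzy" and zero: "\<And>k. k < M \<Longrightarrow> pv (indecision h) k = 0"
  shows "pv h \<in> {pv (\<lambda>x. of_bool (\<phi> x)) | \<phi>. det_quantizer N \<phi>}"
proof -
  define \<phi> where "\<phi> x \<longleftrightarrow> 1/2 < h x" for x
  have [measurable]: "h \<in> borel_measurable N" by (rule fuzzy_measurable[OF h])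
  have \<phi>: "det_quantizer N \<phi>" unfolding det_quantizer_def \<phi>_def by measurable
  have "pv h k = pv (\<lambda>x. of_bool (\<phi> x)) k" for k
  proof (cases "k < M")
    case True
    have "AE x in N. 0 \<le> indecision h x * f k x"
      using fuzzy_bounds[OF indecision_fuzzy(1)[OF h]] f_nonneg True by auto
    then have "AE x in N. indecision h x * f k x = 0"
      using zero[OF True] integral_nonneg_eq_0_iff_AE[OF pv_integrable[OF indecision_fuzzy(1)[OF h] True]] True
      by (simp add: pv_def)
    then have "AE x in N. h x * f k x = of_bool (\<phi> x) * f k x"
      by eventually_elim (auto simp: indecision_def \<phi>_def min_def split: if_splits)
    then show ?thesis using True fuzzy_measurable[OF fuzzy_of_bool[OF \<phi>]]
      unfolding pv_def by (auto intro!: integral_cong_AE)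
  qed (simp add: pv_def)
  with \<phi> show ?thesis by blast
qed

text \<open>An extremality argument: an undecided atom of positive weight could be split
  symmetrically, which would increase the mean squared length. The number \<open>M + 1\<close>
  counts the \<open>M\<close> coordinates of the mean plus one, which is what lets the Caratheodory
  reduction keep the objective too.\<close>

lemma pv_fuzzy_subset_det_mixtures:
  "pv ` fuzzy \<subseteq> mixtures (M + 1) {pv (\<lambda>x. of_bool (\<phi> x)) | \<phi>. det_quantizer N \<phi>}"
proof
  fix v assume v: "v \<in> pv ` fuzzy"
  \<comment> \<open>Coordinate \<open>M\<close>, unused by \<open>pv\<close>, carries the squared length.\<close>
  define aug where "aug e = e(M := (\<Sum>k<M. (e k)\<^sup>2))" for e :: "nat \<Rightarrow> real"
  define K where "K = aug ` (pv ` fuzzy)"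
  \<comment> \<open>The competing mixtures: those with mean \<open>v\<close>, with the objective in
    coordinate \<open>M\<close>.\<close>
  define A where "A = mixtures (M + 1) K \<inter> (\<Inter>k\<in>{..<M}. {u. u k = v k})"
  have "continuous_on UNIV aug"
  proof (rule continuous_on_coordinatewise_then_product)
    fix j show "continuous_on UNIV (\<lambda>e. aug e j)"
      by (cases "j = M") (auto simp: aug_def intro!: continuous_intros)
  qed
  then have "compact K" unfolding K_def
    by (intro compact_continuous_image compact_pv_fuzzy) (rule continuous_on_subset, auto)
  moreover have "closed (\<Inter>k\<in>{..<M}. {u. u k = v k})"
    by (intro closed_INT ballI closed_Collect_eq) auto
  ultimately have "compact A" unfolding A_def by (intro compact_Int_closed compact_mixtures)
  moreover have "A \<noteq> {}"
  proof -
    have "(\<lambda>k. \<Sum>i\<in>{()}. 1 * aug v k) \<in> mixtures (M + 1) K"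
      using v by (intro finite_mixture_in_mixtures) (auto simp: K_def)
    then have "aug v \<in> mixtures (M + 1) K" by simp
    moreover have "aug v k = v k" if "k < M" for k using that by (simp add: aug_def)
    ultimately have "aug v \<in> A" by (simp add: A_def)
    then show ?thesis by blast
  qed
  moreover have "continuous_on A (\<lambda>u. u M)"
    by (rule continuous_on_subset[OF continuous_on_product_coordinates]) auto
  ultimately obtain u where u: "u \<in> A" "\<And>w. w \<in> A \<Longrightarrow> w M \<le> u M"
    using continuous_attains_sup[of A "\<lambda>u. u M"] by blast
  from u(1) have "u \<in> mixtures (M + 1) K" by (simp add: A_def)
  then obtain t z where tz: "u = (\<lambda>k. \<Sum>i<M + 1. t i * z i k)" "\<And>i. i < M + 1 \<Longrightarrow> 0 \<le> t i"
    "\<And>i. i < M + 1 \<Longrightarrow> z i \<in> K" "(\<Sum>i<M + 1. t i) = 1" by (rule mixturesE) blast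
  then have "\<forall>i\<in>{..<M + 1}. \<exists>h\<in>fuzzy. z i = aug (pv h)" by (auto simp: K_def)
  then obtain h where h: "\<And>i. i < M + 1 \<Longrightarrow> h i \<in> fuzzy" "\<And>i. i < M + 1 \<Longrightarrow> z i = aug (pv (h i))"
    by (metis lessThan_iff)
  \<comment> \<open>Splitting every atom \<open>h i\<close> into \<open>h i \<plusminus> indecision (h i)\<close> keeps the mean and increases the mean
    squared length by that of \<open>pv (indecision (h i))\<close>.\<close>
  define sg :: "bool \<Rightarrow> real" where "sg b = (if b then 1 else -1)" for b
  define hh where "hh p = (\<lambda>x. h (fst p) x + sg (snd p) * indecision (h (fst p)) x)" for p :: "nat \<times> bool"
  have hh: "hh p \<in> fuzzy" if "fst p < M + 1" for p
    using indecision_fuzzy[OF h(1)[OF that]] by (cases "snd p") (auto simp: hh_def sg_def)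
  have pvhh: "pv (hh (i, b)) k = pv (h i) k + sg b * pv (indecision (h i)) k" if "i < M + 1" for i b k
    unfolding hh_def fst_conv snd_conv
    by (rule pv_add_scaled[OF indecision_fuzzy(1)[OF h(1)[OF that]] h(1)[OF that]])
  define S where "S = {..<M + 1} \<times> (UNIV :: bool set)"
  have Ssum: "(\<Sum>p\<in>S. t (fst p) / 2 * F p) = (\<Sum>i<M + 1. t i * ((F (i, True) + F (i, False)) / 2))"
    for F :: "nat \<times> bool \<Rightarrow> real"
  proof -
    have "(\<Sum>p\<in>S. t (fst p) / 2 * F p) = (\<Sum>i<M + 1. \<Sum>b\<in>UNIV. t i / 2 * F (i, b))"
      unfolding S_def by (simp add: sum.cartesian_product case_prod_beta)
    also have "\<dots> = (\<Sum>i<M + 1. t i * ((F (i, True) + F (i, False)) / 2))"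
      by (intro sum.cong) (auto simp: UNIV_bool field_simps)
    finally show ?thesis .
  qed
  \<comment> \<open>Splitting doubles the number of atoms. The reduction to \<open>M + 1\<close>
    atoms brings the mixture back into competition without lowering the objective.\<close>
  have "\<exists>w\<in>mixtures (M + 1) K. (\<forall>j\<in>{..<M}. w j = (\<Sum>p\<in>S. t (fst p) / 2 * aug (pv (hh p)) j))
      \<and> (\<Sum>p\<in>S. t (fst p) / 2 * aug (pv (hh p)) M) \<le> w M"
  proof (rule caratheodory_mixture)
    show "(\<Sum>p\<in>S. t (fst p) / 2) = 1" using Ssum[of "\<lambda>_. 1"] tz(4) by simp
    show "0 \<le> t (fst p) / 2" if "p \<in> S" for p using that tz(2) by (auto simp: S_def)
    show "aug (pv (hh p)) \<in> K" if "p \<in> S" for p using that hh by (auto simp: S_def K_def)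
  qed (auto simp: S_def)
  then obtain w where w: "w \<in> mixtures (M + 1) K"
    "\<And>j. j < M \<Longrightarrow> w j = (\<Sum>p\<in>S. t (fst p) / 2 * aug (pv (hh p)) j)"
    "(\<Sum>p\<in>S. t (fst p) / 2 * aug (pv (hh p)) M) \<le> w M" by blast
  have "w j = u j" if "j < M" for j
  proof -
    have "w j = (\<Sum>i<M + 1. t i * pv (h i) j)"
      unfolding w(2)[OF that] Ssum using that
      by (intro sum.cong) (auto simp: aug_def pvhh sg_def)
    also have "\<dots> = u j" unfolding tz(1) using that h(2) by (intro sum.cong) (auto simp: aug_def)
    finally show ?thesis .
  qed
  then have "w \<in> A" using w(1) u(1) by (auto simp: A_def)
  \<comment> \<open>The parallelogram identity for each pair of split atoms.\<close>
  have "(\<Sum>p\<in>S. t (fst p) / 2 * aug (pv (hh p)) M)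
      = (\<Sum>i<M + 1. t i * ((\<Sum>k<M. (pv (h i) k)\<^sup>2) + (\<Sum>k<M. (pv (indecision (h i)) k)\<^sup>2)))"
    unfolding Ssum
  proof (intro sum.cong arg_cong2[where f = "(*)"] refl)
    fix i assume "i \<in> {..<M + 1}"
    then have i: "i < M + 1" by simp
    show "(aug (pv (hh (i, True))) M + aug (pv (hh (i, False))) M) / 2
        = (\<Sum>k<M. (pv (h i) k)\<^sup>2) + (\<Sum>k<M. (pv (indecision (h i)) k)\<^sup>2)"
      by (simp add: aug_def pvhh[OF i] sg_def power2_sum power2_diff sum.distrib sum_subtractf)
  qed
  also have "\<dots> = u M + (\<Sum>i<M + 1. t i * (\<Sum>k<M. (pv (indecision (h i)) k)\<^sup>2))"
  proof -
    have "u M = (\<Sum>i<M + 1. t i * (\<Sum>k<M. (pv (h i) k)\<^sup>2))"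
      unfolding tz(1) using h(2) by (intro sum.cong) (auto simp: aug_def)
    then show ?thesis by (simp add: distrib_left sum.distrib)
  qed
  finally have le0: "(\<Sum>i<M + 1. t i * (\<Sum>k<M. (pv (indecision (h i)) k)\<^sup>2)) \<le> 0"
    using w(3) u(2)[OF \<open>w \<in> A\<close>] by linarith
  have nn: "\<forall>i\<in>{..<M + 1}. 0 \<le> t i * (\<Sum>k<M. (pv (indecision (h i)) k)\<^sup>2)"
    using tz(2) by (auto intro!: mult_nonneg_nonneg sum_nonneg)
  then have zero: "\<forall>i\<in>{..<M + 1}. t i * (\<Sum>k<M. (pv (indecision (h i)) k)\<^sup>2) = 0"
    using le0 sum_nonneg[of "{..<M + 1}" "\<lambda>i. t i * (\<Sum>k<M. (pv (indecision (h i)) k)\<^sup>2)"]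
      sum_nonneg_eq_0_iff[of "{..<M + 1}" "\<lambda>i. t i * (\<Sum>k<M. (pv (indecision (h i)) k)\<^sup>2)"] by force
  \<comment> \<open>Extremality says nothing about atoms of weight zero, so these are
    dropped.\<close>
  define T where "T = {i\<in>{..<M + 1}. t i \<noteq> 0}"
  have det: "pv (h i) \<in> {pv (\<lambda>x. of_bool (\<phi> x)) | \<phi>. det_quantizer N \<phi>}" if "i \<in> T" for i
  proof (rule pv_indecision_eq_0)
    from that show "h i \<in> fuzzy" using h(1) by (simp add: T_def)
    from that zero have "(\<Sum>k<M. (pv (indecision (h i)) k)\<^sup>2) = 0" by (auto simp: T_def)
    then show "pv (indecision (h i)) k = 0" if "k < M" for k
      using that by (subst (asm) sum_nonneg_eq_0_iff) auto
  qed
  have Tsum: "(\<Sum>i\<in>T. t i * F i) = (\<Sum>i<M + 1. t i * F i)" for F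
    unfolding T_def by (intro sum.mono_neutral_left) auto
  have "(\<lambda>k. \<Sum>i\<in>T. t i * pv (h i) k) \<in> mixtures (M + 1) {pv (\<lambda>x. of_bool (\<phi> x)) | \<phi>. det_quantizer N \<phi>}"
  proof (rule finite_mixture_in_mixtures)
    have "card T \<le> card {..<M + 1}" unfolding T_def by (intro card_mono) auto
    then show "card T \<le> M + 1" by simp
    show "sum t T = 1" using Tsum[of "\<lambda>_. 1"] tz(4) by simp
    show "0 \<le> t i" if "i \<in> T" for i using that tz(2) by (simp add: T_def)
  qed (use det in \<open>auto simp: T_def\<close>)
  also have "(\<lambda>k. \<Sum>i\<in>T. t i * pv (h i) k) = v"
  proof
    fix k
    show "(\<Sum>i\<in>T. t i * pv (h i) k) = v k"
    proof (cases "k < M")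
      case True
      then have "v k = u k" using u(1) by (auto simp: A_def)
      also have "\<dots> = (\<Sum>i<M + 1. t i * pv (h i) k)"
        unfolding tz(1) using h(2) True by (intro sum.cong) (auto simp: aug_def)
      finally show ?thesis by (simp add: Tsum)
    next
      case False
      then show ?thesis using v by (auto simp: pv_def)
    qed
  qed
  finally show "v \<in> mixtures (M + 1) {pv (\<lambda>x. of_bool (\<phi> x)) | \<phi>. det_quantizer N \<phi>}" .
qed

section \<open>Mixtures of likelihood quantizers\<close>

definition likelihood_quantizer :: "(nat \<Rightarrow> real) \<Rightarrow> 'a \<Rightarrow> bool" where
  "likelihood_quantizer a x \<longleftrightarrow> 0 < (\<Sum>k<M. a k * f k x)"

lemma comb_measurable [measurable]: "(\<lambda>x. \<Sum>k<M. a k * f k x) \<in> borel_measurable N"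
  by (intro borel_measurable_sum borel_measurable_times) auto

lemma det_likelihood_quantizer: "det_quantizer N (likelihood_quantizer a)"
  unfolding det_quantizer_def likelihood_quantizer_def by measurable

text \<open>The Neyman-Pearson argument: the functional is the integral of \<open>h\<close> against
  the combination of the densities, and it is maximized pointwise by \<open>h = 1\<close> where the
  combination is positive and \<open>h = 0\<close> elsewhere.\<close>

lemma likelihood_quantizer_maximizes:
  assumes h: "h \<in> fuzzy"
  shows "(\<Sum>k<M. a k * pv h k) \<le> (\<Sum>k<M. a k * pv (\<lambda>x. of_bool (likelihood_quantizer a x)) k)"
proof -
  have eq: "(\<Sum>k<M. a k * pv g k) = (\<integral>x. g x * (\<Sum>k<M. a k * f k x) \<partial>N)"
    and int: "integrable N (\<lambda>x. g x * (\<Sum>k<M. a k * f k x))" if g: "g \<in> fuzzy" for g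
  proof -
    have *: "(\<lambda>x. g x * (\<Sum>k<M. a k * f k x)) = (\<lambda>x. \<Sum>k<M. a k * (g x * f k x))"
      by (simp add: sum_distrib_left algebra_simps)
    show "integrable N (\<lambda>x. g x * (\<Sum>k<M. a k * f k x))"
      unfolding * using pv_integrable[OF g]
      by (intro Bochner_Integration.integrable_sum integrable_mult_right) auto
    have "(\<integral>x. (\<Sum>k<M. a k * (g x * f k x)) \<partial>N) = (\<Sum>k<M. \<integral>x. a k * (g x * f k x) \<partial>N)"
      using pv_integrable[OF g] by (intro Bochner_Integration.integral_sum integrable_mult_right) auto
    then show "(\<Sum>k<M. a k * pv g k) = (\<integral>x. g x * (\<Sum>k<M. a k * f k x) \<partial>N)"
      unfolding * by (simp add: pv_def)
  qed
  show ?thesis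
    unfolding eq[OF h] eq[OF fuzzy_of_bool[OF det_likelihood_quantizer]]
  proof (rule integral_mono[OF int[OF h] int[OF fuzzy_of_bool[OF det_likelihood_quantizer]]])
    fix x assume x: "x \<in> space N"
    show "h x * (\<Sum>k<M. a k * f k x) \<le> of_bool (likelihood_quantizer a x) * (\<Sum>k<M. a k * f k x)"
      using fuzzy_bounds[OF h x]
      by (auto simp: likelihood_quantizer_def mult_nonneg_nonpos mult_left_le_one_le)
  qed
qed

text \<open>The unit sphere in the first \<open>M\<close> coordinates. The box constraint gives
  compactness in the product topology; for the coordinates below \<open>M\<close> it follows from
  the norm.\<close>

definition sphere_coeffs :: "(nat \<Rightarrow> real) set" where
  "sphere_coeffs = {a. \<forall>k. a k \<in> {-1..1}} \<inter> {a. (\<Sum>k<M. (a k)\<^sup>2) = 1}"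

lemma compact_sphere_coeffs: "compact sphere_coeffs"
proof -
  have "closed {a :: nat \<Rightarrow> real. (\<Sum>k<M. (a k)\<^sup>2) = 1}"
    by (intro closed_Collect_eq continuous_intros) auto
  then show ?thesis unfolding sphere_coeffs_def by (intro compact_Int_closed compact_Pi_UNIV) auto
qed

lemma sphere_coeffs_nonzero: "a \<in> sphere_coeffs \<Longrightarrow> \<exists>k<M. a k \<noteq> 0"
  by (rule ccontr) (auto simp: sphere_coeffs_def)

lemma normalized_in_sphere_coeffs:
  assumes "0 < (\<Sum>k<M. (a k)\<^sup>2)"
  shows "\<exists>s\<in>sphere_coeffs. likelihood_quantizer s = likelihood_quantizer a"
proof -
  define d where "d = (\<Sum>k<M. (a k)\<^sup>2)"
  define s where "s k = (if k < M then a k / sqrt d else 0)" for k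
  have d: "0 < d" using assms by (simp add: d_def)
  have norm: "(\<Sum>k<M. (s k)\<^sup>2) = 1"
  proof -
    have "(\<Sum>k<M. (s k)\<^sup>2) = (\<Sum>k<M. (a k)\<^sup>2 / d)"
      using d by (intro sum.cong) (auto simp: s_def power_divide)
    also have "\<dots> = 1" using d by (simp flip: d_def sum_divide_distrib)
    finally show ?thesis .
  qed
  have "\<bar>s k\<bar> \<le> 1" for k
  proof (cases "k < M")
    case True
    then have "(s k)\<^sup>2 \<le> (\<Sum>k<M. (s k)\<^sup>2)" by (intro member_le_sum) auto
    then show ?thesis using norm by (simp add: abs_square_le_1)
  qed (simp add: s_def)
  then have "s \<in> sphere_coeffs" using norm by (auto simp: sphere_coeffs_def abs_le_iff minus_le_iff)
  moreover have "likelihood_quantizer s = likelihood_quantizer a"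
  proof
    fix x
    have "(\<Sum>k<M. s k * f k x) = (\<Sum>k<M. a k * f k x) / sqrt d"
      unfolding sum_divide_distrib by (intro sum.cong) (auto simp: s_def)
    then show "likelihood_quantizer s x = likelihood_quantizer a x"
      using d by (simp add: likelihood_quantizer_def zero_less_divide_iff)
  qed
  ultimately show ?thesis by blast
qed

lemma lin_indep_AE:
  assumes "lin_indep_dens N f M" "\<exists>k<M. a k \<noteq> 0" "j < M"
  shows "AE x in N. 0 < f j x \<longrightarrow> (\<Sum>k<M. a k * f k x) \<noteq> 0"
proof -
  have "emeasure (density N (f j)) {x \<in> space N. (\<Sum>k<M. a k * f k x) = 0} = 0"
    using assms unfolding lin_indep_dens_def Pm_def by blast
  then have "AE x in density N (f j). (\<Sum>k<M. a k * f k x) \<noteq> 0"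
    by (subst AE_iff_measurable[OF _ refl]) auto
  then show ?thesis using assms(3) by (subst (asm) AE_density) auto
qed

lemma ULQ_likelihood_quantizer:
  assumes "lin_indep_dens N f M" "a \<in> sphere_coeffs"
  shows "ULQ N f M (likelihood_quantizer a)"
  unfolding ULQ_def using assms sphere_coeffs_nonzero[OF assms(2)]
  by (intro conjI det_likelihood_quantizer exI[of _ a])
    (auto simp: likelihood_quantizer_def lin_indep_dens_def)

text \<open>By linear independence the limiting combination is almost surely nonzero, so its sign is
  eventually constant along the sequence and dominated convergence applies. Normalization keeps the
  limit away from the zero coefficients.\<close>

lemma compact_pv_likelihood_quantizers:
  assumes "lin_indep_dens N f M"
  shows "compact ((\<lambda>a. pv (\<lambda>x. of_bool (likelihood_quantizer a x))) ` sphere_coeffs)"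
proof (rule compact_continuous_image[OF _ compact_sphere_coeffs],
    rule continuous_on_coordinatewise_then_product, rule continuous_on_sequentiallyI)
  fix j u a assume a: "\<forall>n. u n \<in> sphere_coeffs" "a \<in> sphere_coeffs" "u \<longlonglongrightarrow> a"
  show "(\<lambda>n. pv (\<lambda>x. of_bool (likelihood_quantizer (u n) x)) j)
      \<longlonglongrightarrow> pv (\<lambda>x. of_bool (likelihood_quantizer a x)) j"
  proof (cases "j < M")
    case True
    have "(\<lambda>n. \<integral>x. of_bool (likelihood_quantizer (u n) x) * f j x \<partial>N)
        \<longlonglongrightarrow> (\<integral>x. of_bool (likelihood_quantizer a x) * f j x \<partial>N)"
    proof (rule integral_dominated_convergence[where w = "f j"])
      show "AE x in N. (\<lambda>n. of_bool (likelihood_quantizer (u n) x) * f j x)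
          \<longlonglongrightarrow> of_bool (likelihood_quantizer a x) * f j x"
        using lin_indep_AE[OF assms sphere_coeffs_nonzero[OF a(2)] True] AE_f_nonneg[OF True]
      proof eventually_elim
        case (elim x)
        show ?case
        proof (cases "f j x = 0")
          case False
          with elim have ne: "(\<Sum>k<M. a k * f k x) \<noteq> 0" by auto
          have lim: "(\<lambda>n. \<Sum>k<M. u n k * f k x) \<longlonglongrightarrow> (\<Sum>k<M. a k * f k x)"
            by (intro tendsto_sum tendsto_mult tendsto_const tendsto_fun_coordinate a(3))
          have "\<forall>\<^sub>F n in sequentially. likelihood_quantizer (u n) x = likelihood_quantizer a x"
          proof (cases "0 < (\<Sum>k<M. a k * f k x)")
            case True
            show ?thesis using order_tendstoD(1)[OF lim True]
              by eventually_elim (use True in \<open>simp add: likelihood_quantizer_def\<close>)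
          next
            case False
            with ne have neg: "(\<Sum>k<M. a k * f k x) < 0" by auto
            show ?thesis using order_tendstoD(2)[OF lim neg]
              by eventually_elim (use neg in \<open>simp add: likelihood_quantizer_def\<close>)
          qed
          then show ?thesis
            by (intro tendsto_eventually) (auto elim: eventually_mono)
        qed simp
      qed
      show "AE x in N. norm (of_bool (likelihood_quantizer (u n) x) * f j x) \<le> f j x" for n
        using AE_f_nonneg[OF True] by eventually_elim auto
    qed (use True f_integrable fuzzy_measurable[OF fuzzy_of_bool[OF det_likelihood_quantizer]] in auto)
    with True show ?thesis by (simp add: pv_def)
  qed (simp add: pv_def)
qed

text \<open>Separation by a nearest point: in \<open>M\<close> dimensions \<open>M + 1\<close> atoms
  exhaust the convex hull, and if its point \<open>u\<close> closest to \<open>v\<close> differed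
  from \<open>v\<close>, moving towards the likelihood quantizer with coefficients
  \<open>v - u\<close> would come closer.\<close>

lemma pv_fuzzy_subset_ULQ_mixtures:
  assumes "lin_indep_dens N f M" "0 < M"
  shows "pv ` fuzzy \<subseteq> mixtures (M + 1) {pv (\<lambda>x. of_bool (\<phi> x)) | \<phi>. ULQ N f M \<phi>}"
proof
  fix v assume "v \<in> pv ` fuzzy"
  then obtain h where h: "h \<in> fuzzy" "v = pv h" by blast
  define K where "K = (\<lambda>a. pv (\<lambda>x. of_bool (likelihood_quantizer a x))) ` sphere_coeffs"
  define dst where "dst u = (\<Sum>k<M. (u k - v k)\<^sup>2)" for u
  have ULQ: "K \<subseteq> {pv (\<lambda>x. of_bool (\<phi> x)) | \<phi>. ULQ N f M \<phi>}"
    unfolding K_def using ULQ_likelihood_quantizer[OF assms(1)] by blast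
  have "K \<noteq> {}"
    using normalized_in_sphere_coeffs[of "\<lambda>_. 1"] assms(2) by (auto simp: K_def)
  then obtain e0 where "e0 \<in> K" by blast
  then have "(\<lambda>k. \<Sum>i\<in>{()}. 1 * e0 k) \<in> mixtures (M + 1) K"
    by (intro finite_mixture_in_mixtures) auto
  then have ne: "mixtures (M + 1) K \<noteq> {}" by blast
  have "continuous_on UNIV dst"
    unfolding dst_def by (intro continuous_intros) auto
  then have "continuous_on (mixtures (M + 1) K) dst" by (rule continuous_on_subset) auto
  moreover have "compact (mixtures (M + 1) K)"
    unfolding K_def by (intro compact_mixtures compact_pv_likelihood_quantizers assms(1))
  ultimately obtain u where u: "u \<in> mixtures (M + 1) K" "\<And>w. w \<in> mixtures (M + 1) K \<Longrightarrow> dst u \<le> dst w"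
    using continuous_attains_inf[OF _ ne] by blast
  from u(1) obtain t z where tz: "u = (\<lambda>k. \<Sum>i<M + 1. t i * z i k)" "\<And>i. i < M + 1 \<Longrightarrow> 0 \<le> t i"
    "\<And>i. i < M + 1 \<Longrightarrow> z i \<in> K" "(\<Sum>i<M + 1. t i) = 1" by (rule mixturesE) blast
  define d where "d = dst u"
  have "d = 0"
  proof (rule ccontr)
    assume "d \<noteq> 0"
    moreover have "0 \<le> d" unfolding d_def dst_def by (intro sum_nonneg) auto
    ultimately have d: "0 < d" by simp
    define a where "a k = v k - u k" for k
    have da: "d = (\<Sum>k<M. (a k)\<^sup>2)" by (simp add: d_def dst_def a_def power2_commute)
    with d normalized_in_sphere_coeffs[of a] obtain s
      where s: "s \<in> sphere_coeffs" "likelihood_quantizer s = likelihood_quantizer a" by auto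
    define e where "e = pv (\<lambda>x. of_bool (likelihood_quantizer a x))"
    have "e \<in> K" unfolding K_def e_def s(2)[symmetric] using s(1) by (rule imageI)
    have av: "(\<Sum>k<M. a k * v k) \<le> (\<Sum>k<M. a k * e k)"
      unfolding e_def h(2) by (rule likelihood_quantizer_maximizes[OF h(1)])
    define B where "B = (\<Sum>k<M. (e k - u k)\<^sup>2)"
    have B: "0 \<le> B" unfolding B_def by (intro sum_nonneg) auto
    \<comment> \<open>Compare \<open>u\<close> with the point \<open>(1 - \<gamma>) u + \<gamma> e\<close> of the convex hull.\<close>
    have key: "2 * d \<le> \<gamma> * B" if \<gamma>: "0 < \<gamma>" "\<gamma> \<le> 1" for \<gamma>
    proof -
      \<comment> \<open>Index \<open>M + 1\<close> carries the new point \<open>e\<close>; the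
        resulting \<open>M + 2\<close> atoms are reduced to \<open>M + 1\<close> below.\<close>
      define t' where "t' i = (if i < M + 1 then (1 - \<gamma>) * t i else \<gamma>)" for i
      define z' where "z' i = (if i < M + 1 then z i else e)" for i
      have sum': "(\<Sum>i<Suc (M + 1). t' i * F (z' i)) = (1 - \<gamma>) * (\<Sum>i<M + 1. t i * F (z i)) + \<gamma> * F e"
        for F :: "(nat \<Rightarrow> real) \<Rightarrow> real"
      proof -
        have "(\<Sum>i<M + 1. t' i * F (z' i)) = (\<Sum>i<M + 1. (1 - \<gamma>) * (t i * F (z i)))"
          by (intro sum.cong) (auto simp: t'_def z'_def)
        moreover have "t' (M + 1) = \<gamma>" "z' (M + 1) = e" by (auto simp: t'_def z'_def)
        ultimately show ?thesis by (subst sum.lessThan_Suc) (simp only: sum_distrib_left)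
      qed
      have "\<exists>w\<in>mixtures (M + 1) K. (\<forall>j\<in>{..<M}. w j = (\<Sum>i<Suc (M + 1). t' i * z' i j))
          \<and> (\<Sum>i<Suc (M + 1). t' i * z' i 0) \<le> w 0"
      proof (rule caratheodory_mixture)
        show "sum t' {..<Suc (M + 1)} = 1" using sum'[of "\<lambda>_. 1"] tz(4) by simp
        show "0 \<le> t' i" if "i \<in> {..<Suc (M + 1)}" for i using tz(2) \<gamma> by (auto simp: t'_def)
        show "z' i \<in> K" if "i \<in> {..<Suc (M + 1)}" for i using tz(3) \<open>e \<in> K\<close> by (auto simp: z'_def)
      qed auto
      then obtain w where w: "w \<in> mixtures (M + 1) K"
        "\<And>j. j < M \<Longrightarrow> w j = (\<Sum>i<Suc (M + 1). t' i * z' i j)" by blast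
      have wj: "w j = u j + \<gamma> * (e j - u j)" if "j < M" for j
        unfolding w(2)[OF that] sum'[of "\<lambda>y. y j"] tz(1) by (simp add: algebra_simps)
      \<comment> \<open>Minimality of \<open>u\<close> bounds the linear term in
        \<open>\<gamma>\<close> by the quadratic one, whereas the choice of \<open>e\<close> makes
        the inner product of \<open>a\<close> with \<open>e - u\<close> at least
        \<open>d\<close>.\<close>
      have "d \<le> dst w" unfolding d_def by (rule u(2)[OF w(1)])
      also have "dst w = (\<Sum>k<M. (a k)\<^sup>2 - 2 * \<gamma> * (a k * (e k - u k)) + \<gamma>\<^sup>2 * (e k - u k)\<^sup>2)"
        unfolding dst_def by (intro sum.cong) (auto simp: wj a_def power2_eq_square algebra_simps)
      also have "\<dots> = d - 2 * \<gamma> * (\<Sum>k<M. a k * (e k - u k)) + \<gamma>\<^sup>2 * B"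
        unfolding da B_def by (simp add: sum.distrib sum_subtractf sum_distrib_left)
      finally have 1: "2 * \<gamma> * (\<Sum>k<M. a k * (e k - u k)) \<le> \<gamma>\<^sup>2 * B" by simp
      have "(\<Sum>k<M. a k * (e k - u k)) = (\<Sum>k<M. a k * e k) - (\<Sum>k<M. a k * v k) + (\<Sum>k<M. (a k)\<^sup>2)"
        unfolding sum_subtractf[symmetric] sum.distrib[symmetric]
        by (intro sum.cong) (auto simp: a_def power2_eq_square algebra_simps)
      then have "d \<le> (\<Sum>k<M. a k * (e k - u k))" using av da by simp
      then have "2 * \<gamma> * d \<le> 2 * \<gamma> * (\<Sum>k<M. a k * (e k - u k))"
        using \<gamma> by (intro mult_left_mono) auto
      with 1 have "\<gamma> * (2 * d) \<le> \<gamma> * (\<gamma> * B)" by (simp add: power2_eq_square algebra_simps)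
      then show ?thesis using \<gamma> by simp
    qed
    \<comment> \<open>Small enough that \<open>\<gamma> * B \<le> d\<close>, against
      \<open>2 * d \<le> \<gamma> * B\<close>.\<close>
    define \<gamma> where "\<gamma> = min 1 (d / (B + 1))"
    have "0 < \<gamma>" "\<gamma> \<le> 1" using d B by (auto simp: \<gamma>_def)
    then have "2 * d \<le> \<gamma> * B" by (rule key)
    also have "\<dots> \<le> d / (B + 1) * B" using B by (intro mult_right_mono) (auto simp: \<gamma>_def)
    also have "\<dots> \<le> d" using d B by (simp add: field_simps)
    finally show False using d by simp
  qed
  then have "\<forall>k\<in>{..<M}. (u k - v k)\<^sup>2 = 0"
    unfolding d_def dst_def by (subst (asm) sum_nonneg_eq_0_iff) auto
  moreover have "u k = v k" if "\<not> k < M" for k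
  proof -
    have "z i k = 0" if "i < M + 1" for i using tz(3)[OF that] \<open>\<not> k < M\<close> by (auto simp: K_def pv_def)
    then have "u k = 0" unfolding tz(1) by (intro sum.neutral) auto
    with that show ?thesis by (simp add: h pv_def)
  qed
  ultimately have "u = v" by force
  then have "v \<in> mixtures (M + 1) K" using u(1) by simp
  with ULQ show "v \<in> mixtures (M + 1) {pv (\<lambda>x. of_bool (\<phi> x)) | \<phi>. ULQ N f M \<phi>}"
    unfolding mixtures_def by blast
qed

section \<open>Maximin quantizers\<close>

lemma qprob_eq_pv:
  assumes "det_quantizer N \<phi>" "k < M"
  shows "qprob N f k \<phi> True = pv (\<lambda>x. of_bool (\<phi> x)) k" "qprob N f k \<phi> False = 1 - pv (\<lambda>x. of_bool (\<phi> x)) k"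
proof -
  have *: "measure (Pm N f k) {x \<in> space N. \<phi>' x} = pv (\<lambda>x. of_bool (\<phi>' x)) k" if "det_quantizer N \<phi>'" for \<phi>'
  proof -
    have [measurable]: "\<phi>' \<in> N \<rightarrow>\<^sub>M count_space UNIV" using that by (simp add: det_quantizer_def)
    have "measure (Pm N f k) {x \<in> space N. \<phi>' x} = (\<integral>x. indicator {x \<in> space N. \<phi>' x} x \<partial>Pm N f k)"
      by (simp add: Pm_def Int_absorb2)
    also have "\<dots> = (\<integral>x. f k x *\<^sub>R indicator {x \<in> space N. \<phi>' x} x \<partial>N)"
      unfolding Pm_def using assms(2) AE_f_nonneg by (intro integral_density) auto
    also have "\<dots> = pv (\<lambda>x. of_bool (\<phi>' x)) k"
      using assms(2) by (auto simp: pv_def indicator_def intro!: Bochner_Integration.integral_cong)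
    finally show ?thesis .
  qed
  show "qprob N f k \<phi> True = pv (\<lambda>x. of_bool (\<phi> x)) k"
    using *[OF assms(1)] by (simp add: qprob_def)
  have [measurable]: "\<phi> \<in> N \<rightarrow>\<^sub>M count_space UNIV" using assms(1) by (simp add: det_quantizer_def)
  have "det_quantizer N (\<lambda>x. \<not> \<phi> x)" unfolding det_quantizer_def by measurable
  from *[OF this] have "qprob N f k \<phi> False = pv (\<lambda>x. of_bool (\<not> \<phi> x)) k" by (simp add: qprob_def)
  also have "(\<lambda>x. of_bool (\<not> \<phi> x) :: real) = (\<lambda>x. 1 - of_bool (\<phi> x))" by auto
  finally show "qprob N f k \<phi> False = 1 - pv (\<lambda>x. of_bool (\<phi> x)) k"
    using pv_compl[OF fuzzy_of_bool[OF assms(1)] assms(2)] by simp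
qed

lemma Idet_eq_divergence:
  assumes "det_quantizer N \<phi>" "k < M" "l < M" "l \<noteq> k"
  shows "Idet N f k l \<phi> = divergence k (pv (\<lambda>x. of_bool (\<phi> x))) l"
  using assms by (simp add: Idet_def UNIV_bool divergence_def qprob_eq_pv)

lemma Idet_bounds:
  assumes "det_quantizer N \<phi>" "k < M" "l < M" "l \<noteq> k"
  shows "0 \<le> Idet N f k l \<phi>" "Idet N f k l \<phi> \<le> kl_bound k l"
  using divergence_pv_nonneg[OF fuzzy_of_bool[OF assms(1)] assms(2)]
    divergence_pv_le[OF fuzzy_of_bool[OF assms(1)] assms(2-4)]
  by (simp_all add: Idet_eq_divergence[OF assms])

lemma Irand_integrable:
  assumes "rand_quantizer N Q" "k < M" "l < M" "l \<noteq> k"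
  shows "integrable (measure_pmf Q) (Idet N f k l)"
  using assms Idet_bounds
  by (intro measure_pmf.integrable_const_bound[where B = "kl_bound k l"])
    (auto simp: AE_measure_pmf_iff rand_quantizer_def)

lemma Irand_le:
  assumes "rand_quantizer N Q" "k < M" "l < M" "l \<noteq> k"
  shows "Irand N f k l Q \<le> kl_bound k l"
proof -
  have "Irand N f k l Q \<le> (\<integral>\<phi>. kl_bound k l \<partial>measure_pmf Q)"
    unfolding Irand_def using assms Idet_bounds
    by (intro integral_mono_AE Irand_integrable) (auto simp: AE_measure_pmf_iff rand_quantizer_def)
  then show ?thesis by simp
qed

text \<open>Every quantizer outside \<open>S\<close> is charged the uniform bound
  \<open>kl_bound k l\<close>.\<close>

lemma Irand_le_truncated:
  assumes Q: "rand_quantizer N Q" and kl: "k < M" "l < M" "l \<noteq> k"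
    and S: "finite S" "S \<subseteq> set_pmf Q"
  shows "Irand N f k l Q \<le> (\<Sum>\<phi>\<in>S. pmf Q \<phi> * Idet N f k l \<phi>) + kl_bound k l * (1 - sum (pmf Q) S)"
proof -
  let ?D = "Idet N f k l" and ?B = "kl_bound k l"
  have det: "det_quantizer N \<phi>" if "\<phi> \<in> set_pmf Q" for \<phi> using Q that by (simp add: rand_quantizer_def)
  have int: "integrable (measure_pmf Q) (\<lambda>\<phi>. (?D \<phi> - ?B) * indicator S \<phi>)"
    using Irand_integrable[OF Q kl] by (intro integrable_real_mult_indicator) auto
  have "Irand N f k l Q \<le> (\<integral>\<phi>. ?B + (?D \<phi> - ?B) * indicator S \<phi> \<partial>measure_pmf Q)"
    unfolding Irand_def
  proof (rule integral_mono_AE)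
    show "AE \<phi> in measure_pmf Q. ?D \<phi> \<le> ?B + (?D \<phi> - ?B) * indicator S \<phi>"
      using Idet_bounds(2)[OF det kl] by (auto simp: AE_measure_pmf_iff indicator_def)
  qed (use int Irand_integrable[OF Q kl] in auto)
  also have "\<dots> = ?B + (\<integral>\<phi>. (?D \<phi> - ?B) * indicator S \<phi> \<partial>measure_pmf Q)"
    using int by simp
  also have "(\<integral>\<phi>. (?D \<phi> - ?B) * indicator S \<phi> \<partial>measure_pmf Q) = (\<Sum>\<phi>\<in>S. (?D \<phi> - ?B) * pmf Q \<phi>)"
    by (subst integral_measure_pmf_real[OF S(1)]) (auto simp: indicator_def intro!: sum.cong)
  also have "?B + \<dots> = (\<Sum>\<phi>\<in>S. pmf Q \<phi> * ?D \<phi>) + ?B * (1 - sum (pmf Q) S)"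
    by (simp add: algebra_simps sum_subtractf sum_distrib_right)
  finally show ?thesis .
qed

text \<open>Reduces countable mixtures to finite ones: the tail has small mass and bounded
  divergences, and moving its mass to an atom of \<open>S\<close> costs nothing since divergences
  are nonnegative.\<close>

lemma rand_quantizer_finite_approx:
  assumes Q: "rand_quantizer N Q" and k: "k < M" and e: "0 < e"
  shows "\<exists>S w. finite S \<and> S \<subseteq> set_pmf Q \<and> (\<forall>\<phi>\<in>S. 0 \<le> w \<phi>) \<and> sum w S = 1 \<and>
    (\<forall>l<M. l \<noteq> k \<longrightarrow> Irand N f k l Q - e \<le> (\<Sum>\<phi>\<in>S. w \<phi> * Idet N f k l \<phi>))"
proof -
  define B where "B = 1 + (\<Sum>l<M. \<bar>kl_bound k l\<bar>)"
  have B: "0 < B" unfolding B_def by (intro add_pos_nonneg sum_nonneg) auto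
  have Bl: "kl_bound k l \<le> B" if "l < M" for l
    using member_le_sum[of l "{..<M}" "\<lambda>l. \<bar>kl_bound k l\<bar>"] that by (auto simp: B_def)
  \<comment> \<open>The cap at 1 forces \<open>S\<close> to have positive mass, hence to contain an
    atom.\<close>
  define \<delta> where "\<delta> = min 1 (e / B)"
  have "0 < \<delta>" using e B by (simp add: \<delta>_def)
  from pmf_finite_support_approx[OF this, of Q] obtain S
    where S: "S \<subseteq> set_pmf Q" "finite S" "1 - \<delta> < sum (pmf Q) S" by blast
  have "S \<noteq> {}" using S(3) by (auto simp: \<delta>_def)
  then obtain \<phi>0 where \<phi>0: "\<phi>0 \<in> S" by blast
  define r where "r = 1 - sum (pmf Q) S"
  have "sum (pmf Q) S \<le> 1" using measure_measure_pmf_finite[OF S(2), of Q] measure_pmf.prob_le_1[of Q S] by simp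
  then have r: "0 \<le> r" "r < \<delta>" using S(3) by (auto simp: r_def)
  define w where "w \<phi> = pmf Q \<phi> + (if \<phi> = \<phi>0 then r else 0)" for \<phi>
  have wsum: "(\<Sum>\<phi>\<in>S. w \<phi> * F \<phi>) = (\<Sum>\<phi>\<in>S. pmf Q \<phi> * F \<phi>) + r * F \<phi>0" for F :: "('a \<Rightarrow> bool) \<Rightarrow> real"
    using S(2) \<phi>0 by (simp add: w_def distrib_right sum.distrib if_distrib[of "\<lambda>y. y * _"] cong: if_cong)
  have "Irand N f k l Q - e \<le> (\<Sum>\<phi>\<in>S. w \<phi> * Idet N f k l \<phi>)" if l: "l < M" "l \<noteq> k" for l
  proof -
    have "kl_bound k l * r \<le> B * (e / B)"
      using r Bl[OF l(1)] B by (intro mult_mono) (auto simp: \<delta>_def)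
    then have "kl_bound k l * r \<le> e" using B by simp
    moreover have "0 \<le> r * Idet N f k l \<phi>0"
      using r Idet_bounds(1)[OF _ k l, of \<phi>0] \<phi>0 S(1) Q by (auto simp: rand_quantizer_def)
    ultimately show ?thesis
      using Irand_le_truncated[OF Q k l S(2,1)] by (simp add: wsum flip: r_def)
  qed
  moreover have "sum w S = 1" using wsum[of "\<lambda>_. 1"] by (simp add: r_def)
  moreover have "\<forall>\<phi>\<in>S. 0 \<le> w \<phi>" using r by (simp add: w_def)
  ultimately show ?thesis using S by blast
qed

section \<open>Optimal mixtures for a fixed state\<close>

context
  fixes m :: nat
  assumes m: "m < M" and M2: "2 \<le> M"
begin

lemma alternatives: "finite {l. l < M \<and> l \<noteq> m}" "{l. l < M \<and> l \<noteq> m} \<noteq> {}" "card {l. l < M \<and> l \<noteq> m} = M - 1"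
proof -
  have *: "{l. l < M \<and> l \<noteq> m} = {..<M} - {m}" by auto
  show "finite {l. l < M \<and> l \<noteq> m}" by (simp add: *)
  show c: "card {l. l < M \<and> l \<noteq> m} = M - 1" using m by (simp add: *)
  show "{l. l < M \<and> l \<noteq> m} \<noteq> {}"
  proof
    assume "{l. l < M \<and> l \<noteq> m} = {}"
    with c M2 show False by simp
  qed
qed

lemma Imin_set: "{Irand N f m l Q | l. l < M \<and> l \<noteq> m} = (\<lambda>l. Irand N f m l Q) ` {l. l < M \<and> l \<noteq> m}"
  by auto

lemma Imin_le: "l < M \<Longrightarrow> l \<noteq> m \<Longrightarrow> Imin N f M m Q \<le> Irand N f m l Q"
  unfolding Imin_def Imin_set using alternatives(1) by (intro Min_le) auto

lemma Imin_ge: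
  assumes "\<And>l. l < M \<Longrightarrow> l \<noteq> m \<Longrightarrow> c \<le> Irand N f m l Q"
  shows "c \<le> Imin N f M m Q"
  unfolding Imin_def Imin_set using alternatives(1,2) assms by (subst Min_ge_iff) auto

lemma bdd_above_Imin: "bdd_above (Imin N f M m ` {Q. rand_quantizer N Q})"
proof -
  from alternatives(2) obtain l where l: "l < M" "l \<noteq> m" by blast
  show ?thesis
    using Imin_le[OF l] Irand_le[OF _ m l] by (intro bdd_aboveI2[of _ _ "kl_bound m l"]) (auto intro: order_trans)
qed

text \<open>Nearly optimal quantizers are reduced to finite mixtures and then to
  \<open>M - 1\<close> atoms. Their divergence vectors lie in a compact set, and a limit point
  attains the supremum. The atoms of the limit are only known to be randomized tests.\<close>

lemma fuzzy_attains_Isup: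
  "\<exists>v\<in>mixtures (M - 1) (divergence m ` pv ` fuzzy). \<forall>l<M. l \<noteq> m \<longrightarrow> Isup N f M m \<le> v l"
proof -
  let ?V = "mixtures (M - 1) (divergence m ` pv ` fuzzy)"
  have "\<exists>v\<in>?V. \<forall>l<M. l \<noteq> m \<longrightarrow> Isup N f M m - 1 / (real n + 1) \<le> v l" for n
  proof -
    \<comment> \<open>Half of the tolerance pays for near-optimality of \<open>Q\<close>, the other
      half for truncating its support.\<close>
    define e where "e = 1 / (2 * (real n + 1))"
    have e: "0 < e" by (simp add: e_def)
    have "rand_quantizer N (return_pmf (\<lambda>_. True))" by (simp add: rand_quantizer_def det_quantizer_def)
    then have "{Q. rand_quantizer N Q} \<noteq> {}" by blast
    then obtain Q where Q: "rand_quantizer N Q" "Isup N f M m - e < Imin N f M m Q"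
      using e less_cSUP_iff[OF _ bdd_above_Imin, of "Isup N f M m - e"] unfolding Isup_def by auto
    from rand_quantizer_finite_approx[OF Q(1) m e] obtain S w
      where S: "finite S" "S \<subseteq> set_pmf Q" "\<forall>\<phi>\<in>S. 0 \<le> w \<phi>" "sum w S = 1"
        "\<forall>l<M. l \<noteq> m \<longrightarrow> Irand N f m l Q - e \<le> (\<Sum>\<phi>\<in>S. w \<phi> * Idet N f m l \<phi>)" by blast
    have det: "det_quantizer N \<phi>" if "\<phi> \<in> S" for \<phi> using Q(1) S(2) that by (auto simp: rand_quantizer_def)
    have "\<exists>v\<in>?V. \<forall>l\<in>{l. l < M \<and> l \<noteq> m}. (\<Sum>\<phi>\<in>S. w \<phi> * divergence m (pv (\<lambda>x. of_bool (\<phi> x))) l) \<le> v l"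
      using S det alternatives fuzzy_of_bool by (intro caratheodory_dominating) auto
    then obtain v where v: "v \<in> ?V"
      "\<And>l. l < M \<Longrightarrow> l \<noteq> m \<Longrightarrow> (\<Sum>\<phi>\<in>S. w \<phi> * divergence m (pv (\<lambda>x. of_bool (\<phi> x))) l) \<le> v l" by auto
    have "Isup N f M m - 1 / (real n + 1) \<le> v l" if l: "l < M" "l \<noteq> m" for l
    proof -
      have "(\<Sum>\<phi>\<in>S. w \<phi> * Idet N f m l \<phi>) = (\<Sum>\<phi>\<in>S. w \<phi> * divergence m (pv (\<lambda>x. of_bool (\<phi> x))) l)"
        using det l m by (intro sum.cong) (auto simp: Idet_eq_divergence)
      moreover have "1 / (real n + 1) = e + e" by (simp add: e_def field_simps)
      moreover have "Irand N f m l Q - e \<le> (\<Sum>\<phi>\<in>S. w \<phi> * Idet N f m l \<phi>)" using S(5) l by blast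
      ultimately show ?thesis using Q(2) Imin_le[OF l, of Q] v(2)[OF l] by linarith
    qed
    with v(1) show ?thesis by blast
  qed
  then obtain v where v: "\<And>n. v n \<in> ?V"
    "\<And>n l. l < M \<Longrightarrow> l \<noteq> m \<Longrightarrow> Isup N f M m - 1 / (real n + 1) \<le> v n l" by metis
  have "seq_compact ?V"
    by (intro compact_imp_seq_compact compact_mixtures compact_continuous_image
        continuous_on_divergence compact_pv_fuzzy m)
  then obtain u r where u: "u \<in> ?V" "strict_mono r" "(v \<circ> r) \<longlonglongrightarrow> u"
    by (rule seq_compactE[where f = v]) (use v(1) in auto)
  have "Isup N f M m \<le> u l" if l: "l < M" "l \<noteq> m" for l
  proof (rule LIMSEQ_le)
    have "(\<lambda>n. 1 / (real n + 1)) \<longlonglongrightarrow> 0"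
      using LIMSEQ_inverse_real_of_nat by (simp add: inverse_eq_divide add.commute)
    from LIMSEQ_subseq_LIMSEQ[OF this u(2)] have "(\<lambda>n. 1 / (real (r n) + 1)) \<longlonglongrightarrow> 0" by (simp add: o_def)
    from tendsto_diff[OF tendsto_const this]
    show "(\<lambda>n. Isup N f M m - 1 / (real (r n) + 1)) \<longlonglongrightarrow> Isup N f M m" by simp
    show "(\<lambda>n. (v \<circ> r) n l) \<longlonglongrightarrow> u l" by (rule tendsto_fun_coordinate[OF u(3)])
    show "\<exists>n0. \<forall>n\<ge>n0. Isup N f M m - 1 / (real (r n) + 1) \<le> (v \<circ> r) n l" using v(2)[OF l] by auto
  qed
  with u(1) show ?thesis by blast
qed

text \<open>Serves both claims, with \<open>C\<close> the deterministic quantizers or the ULQs. Each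
  fuzzy atom of the optimal mixture is replaced by a mixture over \<open>C\<close>, which lowers no
  divergence by convexity, and the result is thinned to \<open>M - 1\<close> atoms again.\<close>

lemma maximin_from_generating_class:
  assumes C: "\<And>\<phi>. C \<phi> \<Longrightarrow> det_quantizer N \<phi>"
    and gen: "pv ` fuzzy \<subseteq> mixtures R {pv (\<lambda>x. of_bool (\<phi> x)) | \<phi>. C \<phi>}"
  shows "\<exists>Q. maximin N f M m Q \<and> finite (set_pmf Q) \<and> card (set_pmf Q) \<le> M - 1 \<and> (\<forall>\<phi>\<in>set_pmf Q. C \<phi>)"
proof -
  define K where "K = {pv (\<lambda>x. of_bool (\<phi> x)) | \<phi>. C \<phi>}"
  have KF: "K \<subseteq> pv ` fuzzy" using C fuzzy_of_bool by (auto simp: K_def)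
  from fuzzy_attains_Isup obtain v where v: "v \<in> mixtures (M - 1) (divergence m ` pv ` fuzzy)"
    "\<And>l. l < M \<Longrightarrow> l \<noteq> m \<Longrightarrow> Isup N f M m \<le> v l" by blast
  from v(1) obtain t z where tz: "v = (\<lambda>k. \<Sum>i<M - 1. t i * z i k)" "\<And>i. i < M - 1 \<Longrightarrow> 0 \<le> t i"
    "\<And>i. i < M - 1 \<Longrightarrow> z i \<in> divergence m ` pv ` fuzzy" "(\<Sum>i<M - 1. t i) = 1" by (rule mixturesE) blast
  define P where "P i s y \<longleftrightarrow> z i = divergence m (\<lambda>k. \<Sum>j<R. s j * y j k) \<and>
    (\<forall>j<R. 0 \<le> s j \<and> y j \<in> K) \<and> (\<Sum>j<R. s j) = 1" for i s y
  have "\<exists>s y. P i s y" if "i < M - 1" for i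
  proof -
    from tz(3)[OF that] gen obtain e where e: "z i = divergence m e" "e \<in> mixtures R K" by (auto simp: K_def)
    from e(2) show ?thesis unfolding P_def by (rule mixturesE) (use e(1) in blast)
  qed
  then obtain s y where "\<And>i. i < M - 1 \<Longrightarrow> P i (s i) (y i)" by metis
  then have sy: "\<And>i. i < M - 1 \<Longrightarrow> z i = divergence m (\<lambda>k. \<Sum>j<R. s i j * y i j k)"
    "\<And>i j. i < M - 1 \<Longrightarrow> j < R \<Longrightarrow> 0 \<le> s i j" "\<And>i j. i < M - 1 \<Longrightarrow> j < R \<Longrightarrow> y i j \<in> K"
    "\<And>i. i < M - 1 \<Longrightarrow> (\<Sum>j<R. s i j) = 1" by (auto simp: P_def)
  \<comment> \<open>The two-stage mixture as a single one with at most \<open>(M - 1) * R\<close>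
    atoms.\<close>
  define S where "S = {..<M - 1} \<times> {..<R}"
  define w where "w p = t (fst p) * s (fst p) (snd p)" for p
  define x where "x p = divergence m (y (fst p) (snd p))" for p
  have Ssum: "(\<Sum>p\<in>S. w p * F p) = (\<Sum>i<M - 1. t i * (\<Sum>j<R. s i j * F (i, j)))" for F
    unfolding S_def w_def by (simp add: sum.cartesian_product case_prod_beta sum_distrib_left mult.assoc)
  have "\<exists>u\<in>mixtures (M - 1) (divergence m ` K). \<forall>l\<in>{l. l < M \<and> l \<noteq> m}. (\<Sum>p\<in>S. w p * x p l) \<le> u l"
  proof (rule caratheodory_dominating)
    show "sum w S = 1" using Ssum[of "\<lambda>_. 1"] tz(4) sy(4) by simp
    show "0 \<le> w p" if "p \<in> S" for p using that tz(2) sy(2) by (auto simp: S_def w_def)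
    show "x p \<in> divergence m ` K" if "p \<in> S" for p using that sy(3) by (auto simp: S_def x_def)
  qed (use alternatives in \<open>auto simp: S_def\<close>)
  then obtain u where u: "u \<in> mixtures (M - 1) (divergence m ` K)"
    "\<And>l. l < M \<Longrightarrow> l \<noteq> m \<Longrightarrow> (\<Sum>p\<in>S. w p * x p l) \<le> u l" by blast
  have uI: "Isup N f M m \<le> u l" if l: "l < M" "l \<noteq> m" for l
  proof -
    have "v l \<le> (\<Sum>p\<in>S. w p * x p l)"
      unfolding Ssum tz(1) x_def fst_conv snd_conv
    proof (intro sum_mono mult_left_mono)
      fix i assume "i \<in> {..<M - 1}"
      then have i: "i < M - 1" by simp
      then show "0 \<le> t i" by (rule tz(2))
      show "z i l \<le> (\<Sum>j<R. s i j * divergence m (y i j) l)"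
        unfolding sy(1)[OF i] using sy[OF i] KF m by (intro divergence_convex) auto
    qed
    with v(2)[OF l] u(2)[OF l] show ?thesis by linarith
  qed
  from u(1) obtain t' z' where tz': "u = (\<lambda>k. \<Sum>i<M - 1. t' i * z' i k)" "\<And>i. i < M - 1 \<Longrightarrow> 0 \<le> t' i"
    "\<And>i. i < M - 1 \<Longrightarrow> z' i \<in> divergence m ` K" "(\<Sum>i<M - 1. t' i) = 1" by (rule mixturesE) blast
  have "\<exists>\<phi>. C \<phi> \<and> z' i = divergence m (pv (\<lambda>x. of_bool (\<phi> x)))" if "i < M - 1" for i
    using tz'(3)[OF that] by (auto simp: K_def)
  then obtain \<phi> where \<phi>: "\<And>i. i < M - 1 \<Longrightarrow> C (\<phi> i)"
    "\<And>i. i < M - 1 \<Longrightarrow> z' i = divergence m (pv (\<lambda>x. of_bool (\<phi> i x)))" by metis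
  from ex_pmf_with_weights[OF tz'(2,4)] obtain p where p: "set_pmf p \<subseteq> {..<M - 1}" "\<And>i. i < M - 1 \<Longrightarrow> pmf p i = t' i"
    by blast
  \<comment> \<open>The map \<open>\<phi>\<close> may identify indices, which only shrinks the
    support; expectations are computed on the index side.\<close>
  define Q where "Q = map_pmf \<phi> p"
  have set_Q: "set_pmf Q \<subseteq> \<phi> ` {..<M - 1}" using p(1) by (auto simp: Q_def)
  have "card (set_pmf Q) \<le> card (\<phi> ` {..<M - 1})" using set_Q by (intro card_mono) auto
  also have "\<dots> \<le> M - 1" using card_image_le[of "{..<M - 1}" \<phi>] by simp
  finally have card: "card (set_pmf Q) \<le> M - 1" .
  have CQ: "\<forall>\<phi>\<in>set_pmf Q. C \<phi>" using set_Q \<phi>(1) by auto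
  then have rand: "rand_quantizer N Q" using C by (auto simp: rand_quantizer_def)
  have "Irand N f m l Q = u l" if l: "l < M" "l \<noteq> m" for l
  proof -
    have "Irand N f m l Q = (\<integral>i. Idet N f m l (\<phi> i) \<partial>measure_pmf p)"
      by (simp add: Irand_def Q_def)
    also have "\<dots> = (\<Sum>i<M - 1. Idet N f m l (\<phi> i) * pmf p i)"
      using p(1) by (intro integral_measure_pmf_real) auto
    also have "\<dots> = u l"
      unfolding tz'(1) using \<phi> p(2) l m C by (intro sum.cong) (auto simp: Idet_eq_divergence)
    finally show ?thesis .
  qed
  then have "Isup N f M m \<le> Imin N f M m Q" using uI by (intro Imin_ge) simp
  moreover have "Imin N f M m Q \<le> Isup N f M m"
    unfolding Isup_def using rand by (intro cSUP_upper bdd_above_Imin) auto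
  ultimately have "maximin N f M m Q" using rand by (simp add: maximin_def)
  then show ?thesis using card CQ finite_subset[OF set_Q] by blast
qed

end

end

theorem theorem4p3:
  fixes N :: "'a measure" and f :: "nat \<Rightarrow> 'a \<Rightarrow> real" and M :: nat
  assumes "sigma_finite_measure N"
    and "M \<ge> 2"
    and "\<forall>m<M. f m \<in> borel_measurable N"
    and "\<forall>m<M. \<forall>x\<in>space N. 0 \<le> f m x"
    and "\<forall>m<M. prob_space (Pm N f m)"
    and "\<forall>m<M. \<forall>m'<M. m \<noteq> m' \<longrightarrow>
           (AE x in Pm N f m. 0 < f m' x)
         \<and> integrable (Pm N f m) (\<lambda>x. ln (f m x / f m' x))
         \<and> 0 < (\<integral>x. ln (f m x / f m' x) \<partial>Pm N f m)"
    and "m < M"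
  shows "(\<exists>Q. maximin N f M m Q \<and> finite (set_pmf Q) \<and> card (set_pmf Q) \<le> M - 1)
       \<and> (lin_indep_dens N f M \<longrightarrow>
           (\<exists>Q. maximin N f M m Q \<and> finite (set_pmf Q) \<and> card (set_pmf Q) \<le> M - 1
                \<and> (\<forall>\<phi>\<in>set_pmf Q. ULQ N f M \<phi>)))"
proof -
  interpret quantization N f M
  proof (rule quantization.intro)
    fix k l assume kl: "k < M"
    from kl assms(3) show "f k \<in> borel_measurable N" by simp
    from kl assms(5) show "prob_space (Pm N f k)" by simp
    show "0 \<le> f k x" if "x \<in> space N" for x using kl that assms(4) by simp
    assume "l < M" "k \<noteq> l"
    with kl assms(6) show "AE x in Pm N f k. 0 < f l x"
      "integrable (Pm N f k) (\<lambda>x. ln (f k x / f l x))" by simp_all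
  qed
  show ?thesis
  proof (intro conjI impI)
    show "\<exists>Q. maximin N f M m Q \<and> finite (set_pmf Q) \<and> card (set_pmf Q) \<le> M - 1"
      using maximin_from_generating_class[OF assms(7,2) _ pv_fuzzy_subset_det_mixtures] by blast
  next
    assume "lin_indep_dens N f M"
    then have "pv ` fuzzy \<subseteq> mixtures (M + 1) {pv (\<lambda>x. of_bool (\<phi> x)) | \<phi>. ULQ N f M \<phi>}"
      using assms(2) by (intro pv_fuzzy_subset_ULQ_mixtures) auto
    then show "\<exists>Q. maximin N f M m Q \<and> finite (set_pmf Q) \<and> card (set_pmf Q) \<le> M - 1
        \<and> (\<forall>\<phi>\<in>set_pmf Q. ULQ N f M \<phi>)"
      by (rule maximin_from_generating_class[OF assms(7,2), rotated]) (simp add: ULQ_def)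
  qed
qed

end
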